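(* Let $\varrho_0,\varrho_1\in\mathcal P_2(\mathbb R^d)$ with $\operatorname{supp}\varrho_0=B_{R_0}$ and $\operatorname{supp}\varrho_1=B_{R_1}$, $R_0,R_1>0$, and let $\varrho_\alpha$, $\alpha\in[0,1]$, be the geodesic connecting $\varrho_0$ to $\varrho_1$. (1) Let $\varepsilon>0$, $\sigma\in(0,1)$ be fixed and let $V_1\in C^2_c(\mathbb R^d)$ satisfy (V1). Then $\mathcal H^\varepsilon_\sigma$ satisfies $$\mathcal H^\varepsilon_\sigma[\varrho_1]-\mathcal H^\varepsilon_\sigma[\varrho_0]-\frac{d}{d\alpha}\Big|_{\alpha=0}\mathcal H^\varepsilon_\sigma[\varrho_\alpha]\ \ge\ \frac{\lambda_{\varepsilon,\sigma}}2\,d_W^2(\varrho_0,\varrho_1)$$ and is $\lambda_{\varepsilon,\sigma}$-convex along the geodesic connecting $\varrho_0$ with $\varrho_1$, where $$\lambda_{\varepsilon,\sigma}=-\varepsilon^{-2}C_{\varepsilon,\sigma}(1-\sigma)(1+R_0+R_1)$$ for a constant $C_{\varepsilon,\sigma}$ scaling like $C_{\varepsilon,\sigma}\simeq|\log\sigma|+d|\log\varepsilon|+\log\|V_1\|_{L^\infty}$ for $0<\varepsilon,\sigma\ll1$. (2) If $\sigma=0$, $V_1=\mathcal N_1$ and $0<\varepsilon\le1$, then $\mathcal H^\varepsilon$ satisfies $$\mathcal H^\varepsilon[\varrho_1]-\mathcal H^\varepsilon[\varrho_0]-\frac{d}{d\alpha}\Big|_{\alpha=0}\mathcal H^\varepsilon[\varrho_\alpha]\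 \ge\ \frac{\lambda_{\varepsilon}}2\,d_W^2(\varrho_0,\varrho_1)$$ and is $\lambda_\varepsilon$-convex along the geodesic connecting $\varrho_0$ with $\varrho_1$, where $\lambda_\varepsilon=-\varepsilon^{-3}C_R(1+R_0+R_1)$, for a constant $C_R$ depending on $R$ (and the dimension), where $R>0$ is such that $\varrho_0(B_R)\ge1/2$.
   Context: $\mathcal P_2(\mathbb R^d)$: Borel probability measures on $\mathbb R^d$ with finite second moment, with the 2-Wasserstein distance $d_W$. $B_R$: closed ball of radius $R$ centred at $0$. $\langle x\rangle:=\sqrt{1+|x|^2}$, $\mathcal N_1(x)=Z^{-1}\exp(-\langle x\rangle)$ with $Z$ normalising $\int\mathcal N_1=1$. (V1): $V_1\in C_b(\mathbb R^d)\cap C^1(\mathbb R^d)$, $V_1\ge0$, $\|V_1\|_{L^1}=1$, $V_1(x)=V_1(-x)$. $V_\varepsilon(x):=\varepsilon^{-d}V_1(x/\varepsilon)$. $\mathcal H^\varepsilon_\sigma[\rho]:=\int((1-\sigma)V_\varepsilon*\rho+\sigma\mathcal N_1)\log((1-\sigma)V_\varepsilon*\rho+\sigma\mathcal N_1)\,dx$ and $\mathcal H^\varepsilon:=\mathcal H^\varepsilon_0$, i.e. $\mathcal H^\varepsilon[\rho]=\int(V_\varepsilon*\rho)\log(V_\varepsilon*\rho)\,dx$. The geodesic connecting $\varrho_0$ to $\varrho_1$ is $\varrho_\alpha:=((1-\alpha)\pi^1+\alpha\pi^2)_\#\gamma$, $\alpha\in[0,1]$, with $\gamma$ an optimal transport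 plan between $\varrho_0$ and $\varrho_1$ for $d_W$ and $\pi^1,\pi^2$ the coordinate projections of $\mathbb R^{2d}$; the derivative at $\alpha=0$ is one-sided. A functional $\mathcal E$ is $\lambda$-convex along $\varrho_\alpha$ if $\mathcal E[\varrho_\alpha]\le(1-\alpha)\mathcal E[\varrho_0]+\alpha\mathcal E[\varrho_1]-\frac\lambda2\alpha(1-\alpha)d_W^2(\varrho_0,\varrho_1)$ for all $\alpha\in[0,1]$. *)

theory Defs
  imports "HOL-Probability.Probability" "HOL-Library.Landau_Symbols"
begin

text \<open>Euclidean space of dimension \<open>d\<close> is an arbitrary type of class \<^class>\<open>euclidean_space\<close>,
  with \<open>d = DIM('a)\<close>.\<close>

definition P2 :: "'a::euclidean_space measure set" where
  "P2 = {\<mu>. sets \<mu> = sets borel \<and> prob_space \<mu> \<and> integrable \<mu> (\<lambda>x. (norm x)\<^sup>2)}"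

definition supp :: "'a::euclidean_space measure \<Rightarrow> 'a set" where
  "supp \<mu> = {x. \<forall>U. open U \<longrightarrow> x \<in> U \<longrightarrow> emeasure \<mu> U > 0}"

definition couplings ::
  "'a::euclidean_space measure \<Rightarrow> 'a measure \<Rightarrow> ('a \<times> 'a) measure set" where
  "couplings \<mu> \<nu> = {\<gamma>. sets \<gamma> = sets borel \<and> distr \<gamma> borel fst = \<mu> \<and> distr \<gamma> borel snd = \<nu>}"

definition transport_cost :: "('a::euclidean_space \<times> 'a) measure \<Rightarrow> ennreal" where
  "transport_cost \<gamma> = (\<integral>\<^sup>+ p. ennreal ((norm (fst p - snd p))\<^sup>2) \<partial>\<gamma>)"

definition d\<^sub>W :: "'a::euclidean_space measure \<Rightarrow> 'a measure \<Rightarrow> real" where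
  "d\<^sub>W \<mu> \<nu> = sqrt (enn2real (INF \<gamma>\<in>couplings \<mu> \<nu>. transport_cost \<gamma>))"

definition optimal_plan ::
  "('a::euclidean_space \<times> 'a) measure \<Rightarrow> 'a measure \<Rightarrow> 'a measure \<Rightarrow> bool" where
  "optimal_plan \<gamma> \<mu> \<nu> \<longleftrightarrow> \<gamma> \<in> couplings \<mu> \<nu> \<and>
     transport_cost \<gamma> = (INF \<gamma>'\<in>couplings \<mu> \<nu>. transport_cost \<gamma>')"

definition geodesic :: "('a::euclidean_space \<times> 'a) measure \<Rightarrow> real \<Rightarrow> 'a measure" where
  "geodesic \<gamma> \<alpha> = distr \<gamma> borel (\<lambda>p. (1 - \<alpha>) *\<^sub>R fst p + \<alpha> *\<^sub>R snd p)"

text \<open>The curve is meant to be a geodesic from \<open>\<rho> 0\<close> to \<open>\<rho> 1\<close>.\<close>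

definition convex_along ::
  "real \<Rightarrow> ('a::euclidean_space measure \<Rightarrow> real) \<Rightarrow> (real \<Rightarrow> 'a measure) \<Rightarrow> bool" where
  "convex_along l E \<rho> \<longleftrightarrow> (\<forall>\<alpha>\<in>{0..1}.
     E (\<rho> \<alpha>) \<le> (1 - \<alpha>) * E (\<rho> 0) + \<alpha> * E (\<rho> 1) - l / 2 * \<alpha> * (1 - \<alpha>) * (d\<^sub>W (\<rho> 0) (\<rho> 1))\<^sup>2)"

definition C1_map :: "('a::real_normed_vector \<Rightarrow> 'b::real_normed_vector) \<Rightarrow> bool" where
  "C1_map f \<longleftrightarrow> (\<exists>f' :: 'a \<Rightarrow> 'a \<Rightarrow>\<^sub>L 'b.
     (\<forall>x. (f has_derivative blinfun_apply (f' x)) (at x)) \<and> continuous_on UNIV f')"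

definition C2_map :: "('a::real_normed_vector \<Rightarrow> 'b::real_normed_vector) \<Rightarrow> bool" where
  "C2_map f \<longleftrightarrow> (\<exists>f' :: 'a \<Rightarrow> 'a \<Rightarrow>\<^sub>L 'b.
     (\<forall>x. (f has_derivative blinfun_apply (f' x)) (at x)) \<and> C1_map f')"

definition C2c :: "('a::euclidean_space \<Rightarrow> real) \<Rightarrow> bool" where
  "C2c V \<longleftrightarrow> C2_map V \<and> compact (closure {x. V x \<noteq> 0})"

definition kernel_V1 :: "('a::euclidean_space \<Rightarrow> real) \<Rightarrow> bool" where
  "kernel_V1 V \<longleftrightarrow> continuous_on UNIV V \<and> bounded (range V) \<and> C1_map V \<and> (\<forall>x. V x \<ge> 0) \<and>
     integrable lborel V \<and> (\<integral>x. \<bar>V x\<bar> \<partial>lborel) = 1 \<and> (\<forall>x. V x = V (- x))"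

definition Linf_norm :: "('a::euclidean_space \<Rightarrow> real) \<Rightarrow> real" where
  "Linf_norm V = real_of_ereal (esssup lborel (\<lambda>x. ereal \<bar>V x\<bar>))"

definition rescale :: "('a::euclidean_space \<Rightarrow> real) \<Rightarrow> real \<Rightarrow> 'a \<Rightarrow> real" where
  "rescale V \<epsilon> x = V (x /\<^sub>R \<epsilon>) / \<epsilon> ^ DIM('a)"

definition bracket :: "'a::euclidean_space \<Rightarrow> real" where
  "bracket x = sqrt (1 + (norm x)\<^sup>2)"

definition N1 :: "'a::euclidean_space \<Rightarrow> real" where
  "N1 x = exp (- bracket x) / (\<integral>y. exp (- bracket (y::'a)) \<partial>lborel)"

definition conv :: "('a::euclidean_space \<Rightarrow> real) \<Rightarrow> 'a measure \<Rightarrow> 'a \<Rightarrow> real" where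
  "conv V \<rho> x = (\<integral>y. V (x - y) \<partial>\<rho>)"

text \<open>The argument \<open>V\<close> of the functionals below is the unscaled kernel \<open>V\<^sub>1\<close>.\<close>

definition entropy_reg ::
  "('a::euclidean_space \<Rightarrow> real) \<Rightarrow> real \<Rightarrow> real \<Rightarrow> 'a measure \<Rightarrow> real" where
  "entropy_reg V \<epsilon> \<sigma> \<rho> =
     (\<integral>x. (let u = (1 - \<sigma>) * conv (rescale V \<epsilon>) \<rho> x + \<sigma> * N1 x in u * ln u) \<partial>lborel)"

definition entropy_eps :: "('a::euclidean_space \<Rightarrow> real) \<Rightarrow> real \<Rightarrow> 'a measure \<Rightarrow> real" where
  "entropy_eps V \<epsilon> = entropy_reg V \<epsilon> 0"

end

theory Submission
  imports Defs
begin

text \<open>Write \<open>u\<^sub>\<alpha>\<close> for the density \<open>(1 - \<sigma>) V\<^sub>\<epsilon> * \<rho>\<^sub>\<alpha> + \<sigma> N\<^sub>1\<close> along the geodesic. Convexity of \<open>u ln u\<close>, used through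
  its tangent at \<open>u\<^sub>\<alpha>\<close>, gives pointwise
  \<open>u\<^sub>\<alpha> ln u\<^sub>\<alpha> \<le> (1 - \<alpha>) u\<^sub>0 ln u\<^sub>0 + \<alpha> u\<^sub>1 ln u\<^sub>1 + \<bar>1 + ln u\<^sub>\<alpha>\<bar> \<bar>u\<^sub>\<alpha> - (1 - \<alpha>) u\<^sub>0 - \<alpha> u\<^sub>1\<bar>\<close>,
  so the entropy need not be differentiated twice. The factor \<open>\<bar>1 + ln u\<^sub>\<alpha>\<bar>\<close> grows at most linearly in \<open>\<bar>x\<bar>\<close>,
  and the last factor is a second difference of the kernel along transport segments, which after
  integration in \<open>x\<close> is of order \<open>\<epsilon>\<^sup>-\<^sup>2 \<alpha> (1 - \<alpha>) \<bar>p - q\<bar>\<^sup>2\<close>. The one-sided derivative at 0 exists because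
  semiconvexity makes the corrected difference quotients monotone, and the tangent at \<open>u\<^sub>0\<close> bounds
  them from below.\<close>

section \<open>Differences and semiconvexity on the unit interval\<close>

text \<open>The obstacle is that \<open>ln u\<close> is unbounded, since the density decays at
  infinity; second differences of the kernel must therefore be integrated against a growing weight.
  A weight \<open>A + B * norm x\<close> suffices because the density has an exponential lower
  bound. For \<open>\<sigma> > 0\<close> this is \<open>\<sigma> * N1\<close>, so
  \<open>B = 1\<close> and \<open>A\<close> carries \<open>\<bar>ln \<sigma>\<bar>\<close>, together
  with \<open>\<bar>ln \<epsilon>\<bar>\<close> times the dimension from the upper bound on the
  mollified measure. For \<open>\<sigma> = 0\<close> it is the tail of the kernel itself, at length
  scale \<open>\<epsilon>\<close>, so \<open>A\<close> and \<open>B\<close> are of order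
  \<open>1 / \<epsilon>\<close>: this is the third power of \<open>1 / \<epsilon>\<close> in the
  second claim, the other two being the two derivatives of the kernel. The factor
  \<open>1 + R\<^sub>0 + R\<^sub>1\<close> is the price of translating the weight along segments
  inside the larger ball. Only the logarithmic bound and the majorant of the kernel distinguish the
  two claims, so both are instances of one locale.\<close>

text \<open>The Green function of \<open>- d\<^sup>2/dt\<^sup>2\<close> on the unit interval with Dirichlet boundary conditions: it
  turns the defect from linear interpolation of a function into an integral of its second derivative.\<close>

definition green :: "real \<Rightarrow> real \<Rightarrow> real" where
  "green \<alpha> t = indicator {0..\<alpha>} t * ((1 - \<alpha>) * t) + indicator {\<alpha>..1} t * (\<alpha> * (1 - t))"

lemma green_nonneg: "0 \<le> \<alpha> \<Longrightarrow> \<alpha> \<le> 1 \<Longrightarrow> 0 \<le> green \<alpha> t"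
  by (auto simp: green_def indicator_def)

lemma green_outside: "0 \<le> \<alpha> \<Longrightarrow> \<alpha> \<le> 1 \<Longrightarrow> t \<notin> {0..1} \<Longrightarrow> green \<alpha> t = 0"
  by (auto simp: green_def indicator_def)

lemma measurable_green [measurable]: "green \<alpha> \<in> borel_measurable borel"
  unfolding green_def[abs_def] by measurable

text \<open>Integration by parts with explicit antiderivatives on each side of
  \<open>\<alpha>\<close>; the terms in \<open>g' \<alpha>\<close> cancel because both branches of
  the kernel take the value \<open>\<alpha> * (1 - \<alpha>)\<close> there. At
  \<open>t = \<alpha>\<close> both indicators are 1 and \<open>green\<close> is doubled, which
  affects only a null set.\<close>

lemma has_bochner_integral_green:
  fixes g g' g'' :: "real \<Rightarrow> real"
  assumes g: "\<And>t. (g has_real_derivative g' t) (at t)"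
    and g': "\<And>t. (g' has_real_derivative g'' t) (at t)"
    and cont: "continuous_on UNIV g''"
    and \<alpha>: "0 \<le> \<alpha>" "\<alpha> \<le> 1"
  shows "has_bochner_integral lborel (\<lambda>t. green \<alpha> t * g'' t) ((1 - \<alpha>) * g 0 + \<alpha> * g 1 - g \<alpha>)"
proof -
  have contS: "continuous_on S g''" for S
    using cont continuous_on_subset by blast
  have 1: "has_bochner_integral lborel (\<lambda>t. indicator {0..\<alpha>} t *\<^sub>R ((1 - \<alpha>) * t * g'' t))
      ((1 - \<alpha>) * (\<alpha> * g' \<alpha> - g \<alpha>) - (1 - \<alpha>) * (0 * g' 0 - g 0))"
  proof (rule has_bochner_integral_FTC_Icc[OF \<alpha>(1)])
    show "((\<lambda>t. (1 - \<alpha>) * (t * g' t - g t)) has_vector_derivative (1 - \<alpha>) * t * g'' t)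
        (at t within {0..\<alpha>})" for t
      unfolding has_real_derivative_iff_has_vector_derivative[symmetric]
      by (rule has_field_derivative_at_within)
        (auto intro!: derivative_eq_intros g g' simp: algebra_simps)
  qed (intro continuous_intros contS)
  have 2: "has_bochner_integral lborel (\<lambda>t. indicator {\<alpha>..1} t *\<^sub>R (\<alpha> * (1 - t) * g'' t))
      (\<alpha> * ((1 - 1) * g' 1 + g 1) - \<alpha> * ((1 - \<alpha>) * g' \<alpha> + g \<alpha>))"
  proof (rule has_bochner_integral_FTC_Icc[OF \<alpha>(2)])
    show "((\<lambda>t. \<alpha> * ((1 - t) * g' t + g t)) has_vector_derivative \<alpha> * (1 - t) * g'' t)
        (at t within {\<alpha>..1})" for t
      unfolding has_real_derivative_iff_has_vector_derivative[symmetric]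
      by (rule has_field_derivative_at_within)
        (auto intro!: derivative_eq_intros g g' simp: algebra_simps)
  qed (intro continuous_intros contS)
  show ?thesis
    using has_bochner_integral_add[OF 1 2]
    by (simp add: green_def algebra_simps)
qed

lemma nn_integral_green:
  assumes "0 \<le> \<alpha>" "\<alpha> \<le> 1"
  shows "(\<integral>\<^sup>+t. ennreal (green \<alpha> t) \<partial>lborel) = ennreal (\<alpha> * (1 - \<alpha>) / 2)"
proof -
  \<comment> \<open>The test function is \<open>t\<^sup>2 / 2\<close>, with second derivative 1. Its
    interpolation defect is the origin of the factor \<open>\<alpha> * (1 - \<alpha>) / 2\<close> of
    \<lambda>-convexity.\<close>
  have "has_bochner_integral lborel (\<lambda>t. green \<alpha> t * 1) ((1 - \<alpha>) * (0\<^sup>2 / 2) + \<alpha> * (1\<^sup>2 / 2) - \<alpha>\<^sup>2 / 2)"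
    by (rule has_bochner_integral_green[where g' = "\<lambda>t. t"])
      (use assms in \<open>auto intro!: derivative_eq_intros\<close>)
  then have "has_bochner_integral lborel (green \<alpha>) (\<alpha> * (1 - \<alpha>) / 2)"
    by (simp add: power2_eq_square field_simps)
  then show ?thesis
    by (simp add: has_bochner_integral_iff nn_integral_eq_integral green_nonneg assms)
qed

text \<open>The right side is kept as an extended integral so that the integrals over
  \<open>t\<close>, the plan and \<open>x\<close> can later be exchanged by Tonelli.\<close>

lemma second_difference_bound:
  fixes g g' g'' :: "real \<Rightarrow> real"
  assumes "\<And>t. (g has_real_derivative g' t) (at t)"
    and "\<And>t. (g' has_real_derivative g'' t) (at t)"
    and "continuous_on UNIV g''"
    and "\<And>t. \<bar>g'' t\<bar> \<le> m t"
    and \<alpha>: "0 \<le> \<alpha>" "\<alpha> \<le> 1"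
  shows "ennreal \<bar>g \<alpha> - (1 - \<alpha>) * g 0 - \<alpha> * g 1\<bar> \<le> (\<integral>\<^sup>+t. ennreal (green \<alpha> t * m t) \<partial>lborel)"
proof -
  note b = has_bochner_integral_green[OF assms(1-3) \<alpha>]
  have "ennreal \<bar>g \<alpha> - (1 - \<alpha>) * g 0 - \<alpha> * g 1\<bar> = ennreal (norm (\<integral>t. green \<alpha> t * g'' t \<partial>lborel))"
    using has_bochner_integral_integral_eq[OF b] by (simp add: abs_minus_commute algebra_simps)
  also have "\<dots> \<le> (\<integral>\<^sup>+t. norm (green \<alpha> t * g'' t) \<partial>lborel)"
    by (rule integral_norm_bound_ennreal) (use b in \<open>simp add: has_bochner_integral_iff\<close>)
  also have "\<dots> \<le> (\<integral>\<^sup>+t. ennreal (green \<alpha> t * m t) \<partial>lborel)"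
    by (intro nn_integral_mono ennreal_leI)
      (use assms(4) green_nonneg[OF \<alpha>] in \<open>auto simp: abs_mult intro!: mult_mono\<close>)
  finally show ?thesis .
qed

lemma first_difference_bound:
  fixes g g' :: "real \<Rightarrow> real"
  assumes g: "\<And>t. (g has_real_derivative g' t) (at t)"
    and cont: "continuous_on UNIV g'"
    and "\<And>t. \<bar>g' t\<bar> \<le> m t"
    and \<beta>: "0 \<le> \<beta>"
  shows "ennreal \<bar>g \<beta> - g 0\<bar> \<le> (\<integral>\<^sup>+t. ennreal (indicator {0..\<beta>} t * m t) \<partial>lborel)"
proof -
  have b: "has_bochner_integral lborel (\<lambda>t. indicator {0..\<beta>} t *\<^sub>R g' t) (g \<beta> - g 0)"
    using cont continuous_on_subset
    by (intro has_bochner_integral_FTC_Icc[OF \<beta>])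
      (auto simp: has_real_derivative_iff_has_vector_derivative[symmetric]
        intro: has_field_derivative_at_within g)
  have "ennreal \<bar>g \<beta> - g 0\<bar> = ennreal (norm (\<integral>t. indicator {0..\<beta>} t *\<^sub>R g' t \<partial>lborel))"
    using has_bochner_integral_integral_eq[OF b] by simp
  also have "\<dots> \<le> (\<integral>\<^sup>+t. norm (indicator {0..\<beta>} t *\<^sub>R g' t) \<partial>lborel)"
    by (rule integral_norm_bound_ennreal) (use b in \<open>simp add: has_bochner_integral_iff\<close>)
  also have "\<dots> \<le> (\<integral>\<^sup>+t. ennreal (indicator {0..\<beta>} t * m t) \<partial>lborel)"
    by (intro nn_integral_mono ennreal_leI)
      (use assms(3) in \<open>auto simp: indicator_def\<close>)
  finally show ?thesis .
qed

text \<open>Semiconvexity between the end points alone would not order the difference quotients. It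
  is assumed on every initial segment from 0 to \<open>\<beta>\<close>, with an error proportional
  to the squared length; comparing the quotients at \<open>a\<close> and \<open>b\<close> uses
  \<open>\<theta> = a / b\<close>.\<close>

lemma semiconvex_imp_right_derivative:
  fixes f :: "real \<Rightarrow> real"
  assumes semi: "\<And>\<theta> \<beta>. \<theta> \<in> {0..1} \<Longrightarrow> \<beta> \<in> {0..1} \<Longrightarrow>
      f (\<theta> * \<beta>) \<le> (1 - \<theta>) * f 0 + \<theta> * f \<beta> + \<kappa> * \<theta> * (1 - \<theta>) * \<beta>\<^sup>2"
    and lower: "\<And>\<beta>. \<beta> \<in> {0..1} \<Longrightarrow> f 0 - m * \<beta> \<le> f \<beta>" and \<kappa>: "0 \<le> \<kappa>"
  shows "\<exists>D. (f has_real_derivative D) (at_right 0) \<and> - \<kappa> \<le> f 1 - f 0 - D"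
proof -
  define s where "s \<beta> = (f \<beta> - f 0) / \<beta> + \<kappa> * \<beta>" for \<beta>
  define D where "D = Inf (s ` ({0<..} \<inter> {..1}))"
  have mono: "s a \<le> s b" if "0 < a" "a \<le> b" "b \<le> 1" for a b
  proof -
    have "f a \<le> (1 - a / b) * f 0 + a / b * f b + \<kappa> * (a / b) * (1 - a / b) * b\<^sup>2"
      using semi[of "a / b" b] that by (simp add: divide_simps)
    also have "\<dots> = f 0 + a * ((f b - f 0) / b + \<kappa> * (b - a))"
      using that by (simp add: field_simps power2_eq_square)
    finally have "(f a - f 0) / a \<le> (f b - f 0) / b + \<kappa> * (b - a)"
      using that by (simp add: pos_divide_le_eq mult.commute)
    then show ?thesis by (simp add: s_def algebra_simps)
  qed
  have lower': "- m \<le> s b" if "0 < b" "b \<le> 1" for b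
  proof -
    have "- m \<le> (f b - f 0) / b"
      using lower[of b] that by (simp add: pos_le_divide_eq algebra_simps)
    moreover have "0 \<le> \<kappa> * b" using \<kappa> that by simp
    ultimately show ?thesis by (simp add: s_def)
  qed
  have "(s \<longlongrightarrow> D) (at 0 within ({0<..} \<inter> {..1}))"
    unfolding D_def by (rule Lim_right_bound[where K = "- m"]) (auto intro: mono lower')
  moreover have "at 0 within ({0<..} \<inter> {..1}) = at_right (0::real)"
    by (rule at_within_nhd[where S = "{..<1}"]) auto
  ultimately have "(s \<longlongrightarrow> D) (at_right 0)" by simp
  then have "((\<lambda>b. s b - \<kappa> * b) \<longlongrightarrow> D - \<kappa> * 0) (at_right 0)"
    by (intro tendsto_intros)
  then have "((\<lambda>b. (f b - f 0) / (b - 0)) \<longlongrightarrow> D) (at_right 0)"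
    by (simp add: s_def)
  then have der: "(f has_real_derivative D) (at_right 0)"
    by (simp add: has_field_derivative_iff)
  \<comment> \<open>The derivative is the infimum of the corrected quotients, so the quotient at 1
    gives the final inequality with loss exactly \<open>\<kappa>\<close>.\<close>
  have "D \<le> s 1"
    unfolding D_def by (rule cInf_lower) (auto intro!: bdd_belowI[where m = "- m"] lower')
  then show ?thesis using der by (intro exI[of _ D]) (simp add: s_def)
qed

section \<open>Averages over transport segments\<close>

lemma nn_integral_lborel_shift:
  fixes f :: "'a::euclidean_space \<Rightarrow> ennreal"
  assumes [measurable]: "f \<in> borel_measurable borel"
  shows "(\<integral>\<^sup>+x. f (x - z) \<partial>lborel) = (\<integral>\<^sup>+x. f x \<partial>lborel)"
proof -
  have "(\<integral>\<^sup>+x. f x \<partial>lborel) = (\<integral>\<^sup>+x. f x \<partial>distr lborel borel ((+) (- z)))"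
    by (simp only: lborel_distr_plus)
  also have "\<dots> = (\<integral>\<^sup>+x. f (x - z) \<partial>lborel)"
    by (subst nn_integral_distr) simp_all
  finally show ?thesis ..
qed

text \<open>Bounds the integral of \<open>(A + B * norm x) * M (x - z)\<close> simultaneously for
  all shifts with \<open>norm z \<le> R\<close>. It is affine in \<open>R\<close>, which is how the
  radii of the supports come to enter linearly.\<close>

definition moment_bound :: "('a::euclidean_space \<Rightarrow> real) \<Rightarrow> real \<Rightarrow> real \<Rightarrow> real \<Rightarrow> real" where
  "moment_bound M A B R = (A + B * R) * (\<integral>x. M x \<partial>lborel) + B * (\<integral>x. norm x * M x \<partial>lborel)"

definition integrable_weight :: "('a::euclidean_space \<Rightarrow> real) \<Rightarrow> bool" where
  "integrable_weight M \<longleftrightarrow> continuous_on UNIV M \<and> (\<forall>x. 0 \<le> M x) \<and>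
     integrable lborel M \<and> integrable lborel (\<lambda>x. norm x * M x)"

lemma integrable_weightD:
  assumes "integrable_weight M"
  shows "M \<in> borel_measurable borel" "0 \<le> M x" "integrable lborel M"
    "integrable lborel (\<lambda>x. norm x * M x)"
  using assms by (auto simp: integrable_weight_def intro: borel_measurable_continuous_onI)

lemma moment_bound_nonneg:
  assumes "integrable_weight M" "0 \<le> A" "0 \<le> B" "0 \<le> R"
  shows "0 \<le> moment_bound M A B R"
  unfolding moment_bound_def using assms integrable_weightD[OF assms(1)]
  by (intro add_nonneg_nonneg mult_nonneg_nonneg) (auto intro!: integral_nonneg_AE)

lemma nn_integral_weighted_shift_le:
  fixes M :: "'a::euclidean_space \<Rightarrow> real"
  assumes M: "integrable_weight M" and AB: "0 \<le> A" "0 \<le> B" and z: "norm z \<le> R"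
  shows "(\<integral>\<^sup>+x. ennreal ((A + B * norm x) * M (x - z)) \<partial>lborel) \<le> ennreal (moment_bound M A B R)"
proof -
  note [measurable] = integrable_weightD(1)[OF M]
  note M' = integrable_weightD(2-)[OF M]
  have R: "0 \<le> R" using z norm_ge_zero order_trans by blast
  have "(\<integral>\<^sup>+x. ennreal ((A + B * norm x) * M (x - z)) \<partial>lborel)
      \<le> (\<integral>\<^sup>+x. ennreal ((A + B * R + B * norm (x - z)) * M (x - z)) \<partial>lborel)"
  proof (intro nn_integral_mono ennreal_leI mult_right_mono M')
    fix x
    have "norm x \<le> R + norm (x - z)"
      using norm_triangle_ineq[of z "x - z"] z by simp
    then have "B * norm x \<le> B * (R + norm (x - z))"
      using AB by (intro mult_left_mono)
    then show "A + B * norm x \<le> A + B * R + B * norm (x - z)"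
      by (simp add: algebra_simps)
  qed
  also have "\<dots> = (\<integral>\<^sup>+x. ennreal ((A + B * R + B * norm x) * M x) \<partial>lborel)"
    by (rule nn_integral_lborel_shift) measurable
  also have "\<dots> = (\<integral>\<^sup>+x. ennreal ((A + B * R) * M x + B * (norm x * M x)) \<partial>lborel)"
    by (simp add: algebra_simps)
  also have "\<dots> = ennreal (\<integral>x. (A + B * R) * M x + B * (norm x * M x) \<partial>lborel)"
    using AB R M' by (intro nn_integral_eq_integral) auto
  also have "(\<integral>x. (A + B * R) * M x + B * (norm x * M x) \<partial>lborel) = moment_bound M A B R"
    using M' by (simp add: moment_bound_def)
  finally show ?thesis .
qed

definition interp :: "real \<Rightarrow> 'a::euclidean_space \<times> 'a \<Rightarrow> 'a" where
  "interp t p = (1 - t) *\<^sub>R fst p + t *\<^sub>R snd p"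

lemma geodesic_interp: "geodesic \<gamma> t = distr \<gamma> borel (interp t)"
  by (simp add: geodesic_def interp_def[abs_def])

lemma measurable_interp [measurable (raw)]:
  fixes g :: "'b \<Rightarrow> 'a::euclidean_space \<times> 'a"
  assumes [measurable]: "f \<in> borel_measurable N" "g \<in> borel_measurable N"
  shows "(\<lambda>x. interp (f x) (g x)) \<in> borel_measurable N"
proof -
  have "(\<lambda>x :: real \<times> ('a \<times> 'a). interp (fst x) (snd x)) \<in> borel_measurable borel"
    unfolding interp_def
    by (intro borel_measurable_continuous_onI continuous_intros)
  moreover have "(\<lambda>x. (f x, g x)) \<in> borel_measurable N"
    by measurable
  ultimately show ?thesis
    using measurable_compose[of "\<lambda>x. (f x, g x)" N borel "\<lambda>x. interp (fst x) (snd x)" borel] by simp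
qed

lemma norm_interp_le:
  assumes "norm (fst p) \<le> R" "norm (snd p) \<le> R" "t \<in> {0..1}"
  shows "norm (interp t p) \<le> R"
proof -
  have "interp t p \<in> cball 0 R"
    unfolding interp_def using assms
    by (intro convexD[OF convex_cball]) auto
  then show ?thesis by simp
qed

text \<open>After Tonelli the innermost integral is over \<open>x\<close> and sees only a translate
  of \<open>M\<close> by a point of the ball, so it costs at most \<open>moment_bound\<close>,
  uniformly in \<open>t\<close> and \<open>p\<close>. What remains factors into an integral of
  \<open>g\<close> and one of \<open>h\<close>. It serves both for Green's function with the squared
  displacement and for an interval indicator with the displacement.\<close>

lemma weighted_average_bound:
  fixes \<gamma> :: "('a::euclidean_space \<times> 'a) measure" and \<delta> :: "'a \<Rightarrow> 'a \<times> 'a \<Rightarrow> real"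
    and g :: "real \<Rightarrow> real" and h :: "'a \<times> 'a \<Rightarrow> real"
  assumes "prob_space \<gamma>" and \<gamma>: "sets \<gamma> = sets borel"
    and supp: "AE p in \<gamma>. norm (fst p) \<le> R \<and> norm (snd p) \<le> R"
    and M: "integrable_weight M" and AB: "0 \<le> A" "0 \<le> B"
    and [measurable]: "g \<in> borel_measurable borel" "h \<in> borel_measurable borel"
    and g0: "\<And>t. 0 \<le> g t" and g1: "\<And>t. t \<notin> {0..1} \<Longrightarrow> g t = 0" and h0: "\<And>p. 0 \<le> h p"
    and \<delta>: "\<And>x p. ennreal \<bar>\<delta> x p\<bar> \<le> (\<integral>\<^sup>+t. ennreal (g t * h p * M (x - interp t p)) \<partial>lborel)"
  shows "(\<integral>\<^sup>+x. ennreal ((A + B * norm x) * \<bar>\<integral>p. \<delta> x p \<partial>\<gamma>\<bar>) \<partial>lborel)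
    \<le> (\<integral>\<^sup>+t. ennreal (g t) \<partial>lborel) * (\<integral>\<^sup>+p. ennreal (h p) \<partial>\<gamma>) * ennreal (moment_bound M A B R)"
proof -
  interpret prob_space \<gamma> by fact
  interpret P: pair_sigma_finite lborel \<gamma> ..
  note [measurable_cong] = \<gamma>
  note [measurable] = integrable_weightD(1)[OF M]
  note M' = integrable_weightD(2-)[OF M]
  define Q where "Q = moment_bound M A B R"
  have "(\<integral>\<^sup>+x. ennreal ((A + B * norm x) * \<bar>\<integral>p. \<delta> x p \<partial>\<gamma>\<bar>) \<partial>lborel)
     \<le> (\<integral>\<^sup>+x. \<integral>\<^sup>+p. \<integral>\<^sup>+t. ennreal ((A + B * norm x) * (g t * h p * M (x - interp t p))) \<partial>lborel \<partial>\<gamma> \<partial>lborel)"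
  proof (rule nn_integral_mono)
    fix x :: 'a
    have W: "0 \<le> A + B * norm x" using AB by simp
    have "ennreal \<bar>\<integral>p. \<delta> x p \<partial>\<gamma>\<bar> \<le> (\<integral>\<^sup>+p. ennreal \<bar>\<delta> x p\<bar> \<partial>\<gamma>)"
    \<comment> \<open>If \<open>\<delta> x\<close> is not integrable, its Bochner integral is 0 by
      convention and the bound is trivial.\<close>
    proof (cases "integrable \<gamma> (\<delta> x)")
      case True
      from integral_norm_bound_ennreal[OF this] show ?thesis by simp
    qed (simp add: not_integrable_integral_eq)
    also have "\<dots> \<le> (\<integral>\<^sup>+p. \<integral>\<^sup>+t. ennreal (g t * h p * M (x - interp t p)) \<partial>lborel \<partial>\<gamma>)"
      by (intro nn_integral_mono \<delta>)
    finally have "ennreal ((A + B * norm x) * \<bar>\<integral>p. \<delta> x p \<partial>\<gamma>\<bar>)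
       \<le> ennreal (A + B * norm x) * (\<integral>\<^sup>+p. \<integral>\<^sup>+t. ennreal (g t * h p * M (x - interp t p)) \<partial>lborel \<partial>\<gamma>)"
      using W by (simp add: ennreal_mult mult_left_mono)
    also have "\<dots> = (\<integral>\<^sup>+p. \<integral>\<^sup>+t. ennreal ((A + B * norm x) * (g t * h p * M (x - interp t p))) \<partial>lborel \<partial>\<gamma>)"
    proof (subst nn_integral_cmult[symmetric])
      show "(\<integral>\<^sup>+p. ennreal (A + B * norm x) * (\<integral>\<^sup>+t. ennreal (g t * h p * M (x - interp t p)) \<partial>lborel) \<partial>\<gamma>)
        = (\<integral>\<^sup>+p. \<integral>\<^sup>+t. ennreal ((A + B * norm x) * (g t * h p * M (x - interp t p))) \<partial>lborel \<partial>\<gamma>)"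
        using W g0 h0 M' by (intro nn_integral_cong) (simp add: ennreal_mult nn_integral_cmult[symmetric])
    qed measurable
    finally show "ennreal ((A + B * norm x) * \<bar>\<integral>p. \<delta> x p \<partial>\<gamma>\<bar>) \<le> \<dots>" .
  qed
  also have "\<dots> = (\<integral>\<^sup>+p. \<integral>\<^sup>+x. \<integral>\<^sup>+t. ennreal ((A + B * norm x) * (g t * h p * M (x - interp t p))) \<partial>lborel \<partial>lborel \<partial>\<gamma>)"
    by (rule P.Fubini'[symmetric]) measurable
  also have "\<dots> = (\<integral>\<^sup>+p. \<integral>\<^sup>+t. \<integral>\<^sup>+x. ennreal ((A + B * norm x) * (g t * h p * M (x - interp t p))) \<partial>lborel \<partial>lborel \<partial>\<gamma>)"
    by (intro nn_integral_cong lborel_pair.Fubini') measurable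
  also have "\<dots> \<le> (\<integral>\<^sup>+p. (\<integral>\<^sup>+t. ennreal (g t * h p) * ennreal Q \<partial>lborel) \<partial>\<gamma>)"
  proof (rule nn_integral_mono_AE)
    show "AE p in \<gamma>. (\<integral>\<^sup>+t. \<integral>\<^sup>+x. ennreal ((A + B * norm x) * (g t * h p * M (x - interp t p))) \<partial>lborel \<partial>lborel)
        \<le> (\<integral>\<^sup>+t. ennreal (g t * h p) * ennreal Q \<partial>lborel)"
      using supp
    proof eventually_elim
      case (elim p)
      show ?case
      proof (rule nn_integral_mono)
        fix t :: real
        have "(\<integral>\<^sup>+x. ennreal ((A + B * norm x) * (g t * h p * M (x - interp t p))) \<partial>lborel)
            = (\<integral>\<^sup>+x. ennreal (g t * h p) * ennreal ((A + B * norm x) * M (x - interp t p)) \<partial>lborel)"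
          using g0 h0 by (subst ennreal_mult'[symmetric]) (auto simp: algebra_simps)
        also have "\<dots> = ennreal (g t * h p) * (\<integral>\<^sup>+x. ennreal ((A + B * norm x) * M (x - interp t p)) \<partial>lborel)"
          by (rule nn_integral_cmult) measurable
        also have "\<dots> \<le> ennreal (g t * h p) * ennreal Q"
        \<comment> \<open>Outside the unit interval the point \<open>interp t p\<close> may leave
          the ball, but there \<open>g\<close> vanishes.\<close>
        proof (cases "t \<in> {0..1}")
          case True
          then show ?thesis unfolding Q_def
            by (intro mult_left_mono nn_integral_weighted_shift_le M AB norm_interp_le)
              (use elim in auto)
        qed (simp add: g1)
        finally show "(\<integral>\<^sup>+x. ennreal ((A + B * norm x) * (g t * h p * M (x - interp t p))) \<partial>lborel)
            \<le> ennreal (g t * h p) * ennreal Q" .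
      qed
    qed
  qed
  also have "\<dots> = (\<integral>\<^sup>+t. ennreal (g t) \<partial>lborel) * (\<integral>\<^sup>+p. ennreal (h p) \<partial>\<gamma>) * ennreal Q"
    using g0 h0 by (simp add: ennreal_mult nn_integral_multc nn_integral_cmult)
  finally show ?thesis by (simp add: Q_def)
qed

section \<open>Tangent inequalities for \<open>u * ln u\<close>\<close>

lemma xlnx_tangent:
  fixes a b :: real
  assumes "0 < a" "0 < b"
  shows "a * ln a + (1 + ln a) * (b - a) \<le> b * ln b"
proof -
  have "ln a - ln b \<le> a / b - 1"
    using ln_le_minus_one[of "a / b"] assms by (simp add: ln_div)
  then have "b * (ln a - ln b) \<le> b * (a / b - 1)"
    using assms by (intro mult_left_mono) auto
  then show ?thesis using assms by (simp add: algebra_simps)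
qed

lemma xlnx_semiconvex:
  fixes a b v \<alpha> w :: real
  assumes pos: "0 < a" "0 < b" "0 < v" and \<alpha>: "0 \<le> \<alpha>" "\<alpha> \<le> 1" and w: "\<bar>1 + ln v\<bar> \<le> w"
  shows "v * ln v \<le> (1 - \<alpha>) * (a * ln a) + \<alpha> * (b * ln b) + w * \<bar>v - (1 - \<alpha>) * a - \<alpha> * b\<bar>"
proof -
  have "(1 - \<alpha>) * (v * ln v + (1 + ln v) * (a - v)) \<le> (1 - \<alpha>) * (a * ln a)"
    using xlnx_tangent[OF pos(3,1)] \<alpha> by (intro mult_left_mono) auto
  moreover have "\<alpha> * (v * ln v + (1 + ln v) * (b - v)) \<le> \<alpha> * (b * ln b)"
    using xlnx_tangent[OF pos(3,2)] \<alpha> by (intro mult_left_mono) auto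
  ultimately have "v * ln v \<le> (1 - \<alpha>) * (a * ln a) + \<alpha> * (b * ln b) + (1 + ln v) * (v - (1 - \<alpha>) * a - \<alpha> * b)"
    by (simp add: algebra_simps)
  moreover have "\<bar>(1 + ln v) * (v - (1 - \<alpha>) * a - \<alpha> * b)\<bar> \<le> w * \<bar>v - (1 - \<alpha>) * a - \<alpha> * b\<bar>"
    unfolding abs_mult using w by (intro mult_right_mono) auto
  ultimately show ?thesis by linarith
qed

section \<open>Kernels and transport plans\<close>

text \<open>Here \<open>k' w\<close> and \<open>k'' w\<close> are the first and second derivatives of \<open>k\<close> in direction \<open>w\<close>,
  and \<open>1 / a\<close> is the length scale of \<open>k\<close>.\<close>

definition dominated_kernel :: "('a::euclidean_space \<Rightarrow> real) \<Rightarrow> real \<Rightarrow> ('a \<Rightarrow> real) \<Rightarrow> bool" where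
  "dominated_kernel k a M \<longleftrightarrow> integrable_weight M \<and> continuous_on UNIV k \<and> bounded (range k) \<and>
     (\<forall>x. 0 \<le> k x \<and> k x \<le> M x) \<and>
     (\<exists>k' k''. \<forall>w.
        (\<forall>y t. ((\<lambda>t. k (y + t *\<^sub>R w)) has_real_derivative k' w (y + t *\<^sub>R w)) (at t)) \<and>
        (\<forall>y t. ((\<lambda>t. k' w (y + t *\<^sub>R w)) has_real_derivative k'' w (y + t *\<^sub>R w)) (at t)) \<and>
        continuous_on UNIV (k'' w) \<and>
        (\<forall>y. \<bar>k' w y\<bar> \<le> a * norm w * M y \<and> \<bar>k'' w y\<bar> \<le> (a * norm w)\<^sup>2 * M y))"

text \<open>As \<open>t\<close> varies, \<open>x - interp t p\<close> moves along a straight line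
  with constant velocity \<open>fst p - snd p\<close>, so the one-variable estimate applies to the
  restriction of \<open>k\<close> to that line; each derivative contributes one factor
  \<open>a\<close>.\<close>

lemma dominated_kernel_second_difference:
  assumes k: "dominated_kernel k a M" and \<alpha>: "0 \<le> \<alpha>" "\<alpha> \<le> 1"
  shows "ennreal \<bar>k (x - interp \<alpha> p) - (1 - \<alpha>) * k (x - interp 0 p) - \<alpha> * k (x - interp 1 p)\<bar>
    \<le> (\<integral>\<^sup>+t. ennreal (green \<alpha> t * (a * norm (fst p - snd p))\<^sup>2 * M (x - interp t p)) \<partial>lborel)"
proof -
  define w where "w = fst p - snd p"
  define y where "y = x - fst p"
  from k obtain k' k'' where
    1: "\<And>y t. ((\<lambda>t. k (y + t *\<^sub>R w)) has_real_derivative k' w (y + t *\<^sub>R w)) (at t)"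
    and 2: "\<And>y t. ((\<lambda>t. k' w (y + t *\<^sub>R w)) has_real_derivative k'' w (y + t *\<^sub>R w)) (at t)"
    and 3: "continuous_on UNIV (k'' w)"
    and 4: "\<And>y. \<bar>k'' w y\<bar> \<le> (a * norm w)\<^sup>2 * M y"
    unfolding dominated_kernel_def by blast
  have eq: "x - interp t p = y + t *\<^sub>R w" for t
    by (simp add: interp_def w_def y_def algebra_simps)
  have "continuous_on UNIV (\<lambda>t. k'' w (y + t *\<^sub>R w))"
    by (intro continuous_on_compose2[OF 3] continuous_intros) auto
  from second_difference_bound[of "\<lambda>t. k (y + t *\<^sub>R w)" "\<lambda>t. k' w (y + t *\<^sub>R w)"
      "\<lambda>t. k'' w (y + t *\<^sub>R w)" "\<lambda>t. (a * norm w)\<^sup>2 * M (y + t *\<^sub>R w)", OF 1 2 this 4 \<alpha>]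
  show ?thesis by (simp add: eq w_def[symmetric] mult.assoc)
qed

lemma dominated_kernel_first_difference:
  assumes k: "dominated_kernel k a M" and \<beta>: "0 \<le> \<beta>"
  shows "ennreal \<bar>k (x - interp \<beta> p) - k (x - interp 0 p)\<bar>
    \<le> (\<integral>\<^sup>+t. ennreal (indicator {0..\<beta>} t * (a * norm (fst p - snd p)) * M (x - interp t p)) \<partial>lborel)"
proof -
  define w where "w = fst p - snd p"
  define y where "y = x - fst p"
  from k obtain k' k'' where
    1: "\<And>y t. ((\<lambda>t. k (y + t *\<^sub>R w)) has_real_derivative k' w (y + t *\<^sub>R w)) (at t)"
    and 2: "\<And>y t. ((\<lambda>t. k' w (y + t *\<^sub>R w)) has_real_derivative k'' w (y + t *\<^sub>R w)) (at t)"
    and 4: "\<And>y. \<bar>k' w y\<bar> \<le> a * norm w * M y"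
    unfolding dominated_kernel_def by blast
  have eq: "x - interp t p = y + t *\<^sub>R w" for t
    by (simp add: interp_def w_def y_def algebra_simps)
  have "continuous_on UNIV (\<lambda>t. k' w (y + t *\<^sub>R w))"
    using DERIV_isCont[OF 2[of y]] by (simp add: continuous_at_imp_continuous_on)
  from first_difference_bound[of "\<lambda>t. k (y + t *\<^sub>R w)" "\<lambda>t. k' w (y + t *\<^sub>R w)"
      "\<lambda>t. a * norm w * M (y + t *\<^sub>R w)", OF 1 this 4 \<beta>]
  show ?thesis by (simp add: eq w_def[symmetric] mult.assoc)
qed

section \<open>Plans and measures carried by a ball\<close>

text \<open>The supports enter the estimates only through this almost sure bound. Unlike the
  condition that a support equals a ball, it passes directly to intermediate measures and to
  truncated plans.\<close>

definition ball_plan :: "real \<Rightarrow> ('a::euclidean_space \<times> 'a) measure \<Rightarrow> bool" where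
  "ball_plan R \<gamma> \<longleftrightarrow> prob_space \<gamma> \<and> sets \<gamma> = sets borel \<and>
     (AE p in \<gamma>. norm (fst p) \<le> R \<and> norm (snd p) \<le> R)"

definition ball_prob :: "real \<Rightarrow> 'a::euclidean_space measure \<Rightarrow> bool" where
  "ball_prob R \<rho> \<longleftrightarrow> prob_space \<rho> \<and> sets \<rho> = sets borel \<and> (AE y in \<rho>. norm y \<le> R)"

lemma interp_measurable_plan:
  assumes "sets \<gamma> = sets borel"
  shows "interp t \<in> measurable \<gamma> (borel :: 'a::euclidean_space measure)"
proof -
  have "interp t \<in> measurable borel (borel :: 'a measure)"
    unfolding interp_def[abs_def]
    by (intro borel_measurable_continuous_onI continuous_intros)
  then show ?thesis
    by (simp only: measurable_cong_sets[OF assms refl])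
qed

lemma ball_prob_geodesic:
  assumes \<gamma>: "ball_plan R \<gamma>" and t: "t \<in> {0..1}"
  shows "ball_prob R (geodesic \<gamma> t)"
proof -
  have sets: "sets \<gamma> = sets borel" using \<gamma> by (simp add: ball_plan_def)
  interpret prob_space \<gamma> using \<gamma> by (simp add: ball_plan_def)
  have "AE p in \<gamma>. norm (interp t p) \<le> R"
    using \<gamma>[unfolded ball_plan_def, THEN conjunct2, THEN conjunct2]
    by eventually_elim (rule norm_interp_le[OF _ _ t], auto)
  then have "AE y in distr \<gamma> borel (interp t). norm y \<le> R"
    by (subst AE_distr_iff[OF interp_measurable_plan[OF sets]]) auto
  then show ?thesis
    unfolding ball_prob_def geodesic_interp
    using prob_space_distr[OF interp_measurable_plan[OF sets]] by simp
qed

lemma conv_geodesic: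
  assumes "sets \<gamma> = sets borel" and "k \<in> borel_measurable borel"
  shows "conv k (geodesic \<gamma> t) x = (\<integral>p. k (x - interp t p) \<partial>\<gamma>)"
proof -
  have "(\<lambda>y. k (x - y)) \<in> borel_measurable borel"
    using assms(2) by measurable
  then show ?thesis
    unfolding conv_def geodesic_interp
    by (rule integral_distr[OF interp_measurable_plan[OF assms(1)]])
qed

text \<open>\<open>\<gamma>'\<close> stops every particle at time \<open>\<beta>\<close>. It turns
  an estimate between end points into one on each initial segment of the geodesic, as the derivative
  at 0 requires. The entropy estimates are stated for a plan of known cost rather than an optimal
  one so that they apply to \<open>\<gamma>'\<close>.\<close>

lemma ball_plan_truncate:
  assumes \<gamma>: "ball_plan R \<gamma>" and \<beta>: "\<beta> \<in> {0..1}" and c: "transport_cost \<gamma> = ennreal c"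
  defines "\<gamma>' \<equiv> distr \<gamma> borel (\<lambda>p. (fst p, interp \<beta> p))"
  shows "ball_plan R \<gamma>'" "transport_cost \<gamma>' = ennreal (\<beta>\<^sup>2 * c)" "geodesic \<gamma>' \<theta> = geodesic \<gamma> (\<theta> * \<beta>)"
proof -
  have sets: "sets \<gamma> = sets borel" using \<gamma> by (simp add: ball_plan_def)
  interpret prob_space \<gamma> using \<gamma> by (simp add: ball_plan_def)
  have meas: "(\<lambda>p. (fst p, interp \<beta> p)) \<in> measurable \<gamma> borel"
    unfolding measurable_cong_sets[OF sets refl] interp_def
    by (intro borel_measurable_continuous_onI continuous_intros)
  have pred: "Measurable.pred borel (\<lambda>p :: 'a \<times> 'a. norm (fst p) \<le> R \<and> norm (snd p) \<le> R)"
    unfolding borel_prod[symmetric] by measurable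
  have "AE p in \<gamma>. norm (fst p) \<le> R \<and> norm (interp \<beta> p) \<le> R"
    using \<gamma>[unfolded ball_plan_def, THEN conjunct2, THEN conjunct2]
    by eventually_elim (use norm_interp_le[OF _ _ \<beta>] in auto)
  then have "AE p in \<gamma>'. norm (fst p) \<le> R \<and> norm (snd p) \<le> R"
    unfolding \<gamma>'_def using pred by (subst AE_distr_iff[OF meas]) (auto simp: pred_def)
  then show "ball_plan R \<gamma>'"
    unfolding ball_plan_def using prob_space_distr[OF meas] by (simp add: \<gamma>'_def)
  have "transport_cost \<gamma>' = (\<integral>\<^sup>+p. ennreal ((norm (fst p - interp \<beta> p))\<^sup>2) \<partial>\<gamma>)"
    unfolding transport_cost_def \<gamma>'_def
    by (subst nn_integral_distr[OF meas]) (auto simp: borel_prod[symmetric])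
  also have "\<dots> = (\<integral>\<^sup>+p. ennreal (\<beta>\<^sup>2) * ennreal ((norm (fst p - snd p))\<^sup>2) \<partial>\<gamma>)"
  proof (intro nn_integral_cong)
    fix p
    have "fst p - interp \<beta> p = \<beta> *\<^sub>R (fst p - snd p)"
      by (simp add: interp_def algebra_simps)
    then show "ennreal ((norm (fst p - interp \<beta> p))\<^sup>2) = ennreal (\<beta>\<^sup>2) * ennreal ((norm (fst p - snd p))\<^sup>2)"
      by (simp add: power_mult_distrib ennreal_mult)
  qed
  also have "\<dots> = ennreal (\<beta>\<^sup>2) * transport_cost \<gamma>"
    unfolding transport_cost_def
    by (rule nn_integral_cmult) (simp add: measurable_cong_sets[OF sets refl] borel_prod[symmetric])
  finally show "transport_cost \<gamma>' = ennreal (\<beta>\<^sup>2 * c)"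
    by (simp add: c ennreal_mult')
  have "geodesic \<gamma>' \<theta> = distr \<gamma> borel (interp \<theta> \<circ> (\<lambda>p. (fst p, interp \<beta> p)))"
    unfolding geodesic_interp \<gamma>'_def
    by (intro distr_distr[OF _ meas] interp_measurable_plan refl)
  also have "interp \<theta> \<circ> (\<lambda>p. (fst p, interp \<beta> p)) = interp (\<theta> * \<beta>)"
    by (auto simp: interp_def algebra_simps)
  finally show "geodesic \<gamma>' \<theta> = geodesic \<gamma> (\<theta> * \<beta>)"
    by (simp add: geodesic_interp)
qed

section \<open>Semiconvexity of the entropy\<close>

text \<open>Both claims are instances: \<open>s = 1 - \<sigma>\<close> with \<open>N\<close> equal
  to \<open>\<sigma> * N1\<close>, or \<open>s = 1\<close> with \<open>N\<close> zero. The bound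
  \<open>log_bound\<close> is uniform over all measures carried by the ball because it is applied at
  every time of the geodesic; it also makes the entropy integrable.\<close>

locale regularized_entropy =
  fixes k M N :: "'a::euclidean_space \<Rightarrow> real" and a s R A B :: real
  assumes kernel: "dominated_kernel k a M" and N: "integrable_weight N"
    and a: "0 \<le> a" and s: "0 \<le> s" and R: "0 \<le> R" and A: "0 \<le> A" and B: "0 \<le> B"
    and log_bound: "ball_prob R \<rho> \<Longrightarrow>
      0 < s * conv k \<rho> x + N x \<and> \<bar>1 + ln (s * conv k \<rho> x + N x)\<bar> \<le> A + B * norm x"
begin

definition dens :: "'a measure \<Rightarrow> 'a \<Rightarrow> real" where
  "dens \<rho> x = s * conv k \<rho> x + N x"

definition ent :: "'a measure \<Rightarrow> real" where
  "ent \<rho> = (\<integral>x. dens \<rho> x * ln (dens \<rho> x) \<partial>lborel)"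

lemma dens_pos: "ball_prob R \<rho> \<Longrightarrow> 0 < dens \<rho> x"
  and ln_dens_bound: "ball_prob R \<rho> \<Longrightarrow> \<bar>1 + ln (dens \<rho> x)\<bar> \<le> A + B * norm x"
  using log_bound by (auto simp: dens_def)

lemma M: "integrable_weight M"
  and k_measurable [measurable]: "k \<in> borel_measurable borel"
  and k_bounded: "bounded (range k)"
  and k_nonneg: "0 \<le> k x" and k_le: "k x \<le> M x"
  using kernel by (auto simp: dominated_kernel_def intro: borel_measurable_continuous_onI)

lemma N_measurable [measurable]: "N \<in> borel_measurable borel"
  and M_measurable [measurable]: "M \<in> borel_measurable borel"
  using integrable_weightD(1) N M by auto

lemma integrable_k:
  assumes "prob_space \<mu>" "f \<in> borel_measurable \<mu>"
  shows "integrable \<mu> (\<lambda>p. k (f p))"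
proof -
  interpret prob_space \<mu> by fact
  note [measurable] = assms(2)
  obtain b where "\<And>x. norm (k x) \<le> b"
    using k_bounded unfolding bounded_iff by auto
  then show ?thesis
    by (intro integrable_const_bound[where B = b]) auto
qed

lemma measurable_dens:
  assumes "ball_prob R \<rho>"
  shows "dens \<rho> \<in> borel_measurable borel"
proof -
  interpret prob_space \<rho> using assms by (simp add: ball_prob_def)
  have [measurable_cong]: "sets \<rho> = sets borel" using assms by (simp add: ball_prob_def)
  show ?thesis unfolding dens_def[abs_def] conv_def by measurable
qed

lemma conv_nonneg: "0 \<le> conv k \<rho> x"
  unfolding conv_def by (intro integral_nonneg_AE) (simp add: k_nonneg)

lemma nn_integral_weighted_conv_finite:
  assumes \<rho>: "ball_prob R \<rho>" and "0 \<le> A'"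
  shows "(\<integral>\<^sup>+x. ennreal ((A' + B * norm x) * conv k \<rho> x) \<partial>lborel) < \<infinity>"
proof -
  interpret prob_space \<rho> using \<rho> by (simp add: ball_prob_def)
  interpret P: pair_sigma_finite lborel \<rho> ..
  have sets [measurable_cong]: "sets \<rho> = sets borel" using \<rho> by (simp add: ball_prob_def)
  have "(\<integral>\<^sup>+x. ennreal ((A' + B * norm x) * conv k \<rho> x) \<partial>lborel)
      \<le> (\<integral>\<^sup>+x. \<integral>\<^sup>+y. ennreal ((A' + B * norm x) * M (x - y)) \<partial>\<rho> \<partial>lborel)"
  proof (rule nn_integral_mono)
    fix x :: 'a
    have W: "0 \<le> A' + B * norm x" using assms B by simp
    have "integrable \<rho> (\<lambda>y. k (x - y))"
      by (intro integrable_k prob_space_axioms) measurable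
    then have "ennreal ((A' + B * norm x) * conv k \<rho> x) = (\<integral>\<^sup>+y. ennreal ((A' + B * norm x) * k (x - y)) \<partial>\<rho>)"
      unfolding conv_def using W k_nonneg by (subst nn_integral_eq_integral) auto
    also have "\<dots> \<le> (\<integral>\<^sup>+y. ennreal ((A' + B * norm x) * M (x - y)) \<partial>\<rho>)"
      using W k_le by (intro nn_integral_mono ennreal_leI mult_left_mono)
    finally show "ennreal ((A' + B * norm x) * conv k \<rho> x) \<le> \<dots>" .
  qed
  also have "\<dots> = (\<integral>\<^sup>+y. \<integral>\<^sup>+x. ennreal ((A' + B * norm x) * M (x - y)) \<partial>lborel \<partial>\<rho>)"
    by (rule P.Fubini'[symmetric]) measurable
  also have "\<dots> \<le> (\<integral>\<^sup>+y. ennreal (moment_bound M A' B R) \<partial>\<rho>)"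
    using \<rho>[unfolded ball_prob_def, THEN conjunct2, THEN conjunct2]
    by (intro nn_integral_mono_AE, eventually_elim)
      (rule nn_integral_weighted_shift_le[OF M \<open>0 \<le> A'\<close> B])
  also have "\<dots> < \<infinity>"
    by (simp add: emeasure_space_1)
  finally show ?thesis .
qed

lemma integrable_weighted_dens:
  assumes \<rho>: "ball_prob R \<rho>" and A': "0 \<le> A'"
  shows "integrable lborel (\<lambda>x. (A' + B * norm x) * dens \<rho> x)"
proof -
  interpret prob_space \<rho> using \<rho> by (simp add: ball_prob_def)
  have [measurable_cong]: "sets \<rho> = sets borel" using \<rho> by (simp add: ball_prob_def)
  have "integrable lborel (\<lambda>x. (A' + B * norm x) * conv k \<rho> x)"
  proof (rule integrableI_nonneg)
    show "(\<lambda>x. (A' + B * norm x) * conv k \<rho> x) \<in> borel_measurable lborel"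
      unfolding conv_def by measurable
  qed (use nn_integral_weighted_conv_finite[OF assms] A' B conv_nonneg in auto)
  then have "integrable lborel (\<lambda>x. s * ((A' + B * norm x) * conv k \<rho> x) + (A' * N x + B * (norm x * N x)))"
    using integrable_weightD[OF N] by simp
  then show ?thesis
    by (simp add: dens_def algebra_simps)
qed

lemma integrable_entropy:
  assumes \<rho>: "ball_prob R \<rho>"
  shows "integrable lborel (\<lambda>x. dens \<rho> x * ln (dens \<rho> x))"
proof (rule Bochner_Integration.integrable_bound)
  \<comment> \<open>\<open>log_bound\<close> controls \<open>1 + ln u\<close>; passing to
    \<open>ln u\<close> costs one more in \<open>A\<close>.\<close>
  show "integrable lborel (\<lambda>x. ((A + 1) + B * norm x) * dens \<rho> x)"
    using A by (intro integrable_weighted_dens \<rho>) simp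
  show "(\<lambda>x. dens \<rho> x * ln (dens \<rho> x)) \<in> borel_measurable lborel"
    using measurable_dens[OF \<rho>] by measurable
  show "AE x in lborel. norm (dens \<rho> x * ln (dens \<rho> x)) \<le> norm (((A + 1) + B * norm x) * dens \<rho> x)"
  proof (intro AE_I2)
    fix x :: 'a
    have "\<bar>ln (dens \<rho> x)\<bar> \<le> (A + 1) + B * norm x"
      using ln_dens_bound[OF \<rho>, of x] by simp
    moreover have "0 \<le> (A + 1) + B * norm x"
      using A B by simp
    ultimately show "norm (dens \<rho> x * ln (dens \<rho> x)) \<le> norm (((A + 1) + B * norm x) * dens \<rho> x)"
      using dens_pos[OF \<rho>, of x] by (simp add: abs_mult mult.commute)
  qed
qed

text \<open>Returns from extended integrals to Bochner integrals once, for second and first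
  differences alike: \<open>G\<close> bounds the mass of the time kernel and \<open>H\<close> the
  average displacement term.\<close>

lemma weighted_difference:
  assumes \<gamma>: "ball_plan R \<gamma>" and D: "\<And>x. D x = s * (\<integral>p. \<delta> x p \<partial>\<gamma>)"
    and [measurable]: "(\<lambda>x. \<integral>p. \<delta> x p \<partial>\<gamma>) \<in> borel_measurable borel"
    and g: "g \<in> borel_measurable borel" "\<And>t. 0 \<le> g t" "\<And>t. t \<notin> {0..1} \<Longrightarrow> g t = 0"
    and h: "h \<in> borel_measurable borel" "\<And>p. 0 \<le> h p"
    and \<delta>: "\<And>x p. ennreal \<bar>\<delta> x p\<bar> \<le> (\<integral>\<^sup>+t. ennreal (g t * h p * M (x - interp t p)) \<partial>lborel)"
    and G: "(\<integral>\<^sup>+t. ennreal (g t) \<partial>lborel) \<le> ennreal G" "0 \<le> G"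
    and H: "(\<integral>\<^sup>+p. ennreal (h p) \<partial>\<gamma>) \<le> ennreal H" "0 \<le> H"
  shows "integrable lborel (\<lambda>x. (A + B * norm x) * \<bar>D x\<bar>) \<and>
    (\<integral>x. (A + B * norm x) * \<bar>D x\<bar> \<partial>lborel) \<le> s * G * H * moment_bound M A B R"
proof -
  define Q where "Q = moment_bound M A B R"
  have Q: "0 \<le> Q" unfolding Q_def by (rule moment_bound_nonneg[OF M A B R])
  have W: "0 \<le> A + B * norm x" for x :: 'a using A B by simp
  have "(\<integral>\<^sup>+x. ennreal ((A + B * norm x) * \<bar>\<integral>p. \<delta> x p \<partial>\<gamma>\<bar>) \<partial>lborel)
      \<le> (\<integral>\<^sup>+t. ennreal (g t) \<partial>lborel) * (\<integral>\<^sup>+p. ennreal (h p) \<partial>\<gamma>) * ennreal Q"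
    unfolding Q_def using \<gamma> unfolding ball_plan_def
    by (intro weighted_average_bound[OF _ _ _ M A B g(1) h(1) g(2) g(3) h(2) \<delta>]) auto
  also have "\<dots> \<le> ennreal G * ennreal H * ennreal Q"
    by (intro mult_right_mono mult_mono G H) auto
  finally have bound: "(\<integral>\<^sup>+x. ennreal ((A + B * norm x) * \<bar>\<integral>p. \<delta> x p \<partial>\<gamma>\<bar>) \<partial>lborel) \<le> ennreal (G * H * Q)"
    using G H Q by (simp add: ennreal_mult)
  have "(\<integral>\<^sup>+x. ennreal ((A + B * norm x) * \<bar>D x\<bar>) \<partial>lborel)
      = (\<integral>\<^sup>+x. ennreal s * ennreal ((A + B * norm x) * \<bar>\<integral>p. \<delta> x p \<partial>\<gamma>\<bar>) \<partial>lborel)"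
    using s W by (simp add: D abs_mult mult.left_commute flip: ennreal_mult)
  also have "\<dots> = ennreal s * (\<integral>\<^sup>+x. ennreal ((A + B * norm x) * \<bar>\<integral>p. \<delta> x p \<partial>\<gamma>\<bar>) \<partial>lborel)"
    by (rule nn_integral_cmult) measurable
  also have "\<dots> \<le> ennreal s * ennreal (G * H * Q)"
    by (intro mult_left_mono bound) simp
  finally have le: "(\<integral>\<^sup>+x. ennreal ((A + B * norm x) * \<bar>D x\<bar>) \<partial>lborel) \<le> ennreal (s * G * H * Q)"
    using s by (simp add: ennreal_mult'[symmetric] mult.assoc)
  have int: "integrable lborel (\<lambda>x. (A + B * norm x) * \<bar>D x\<bar>)"
  proof (rule integrableI_nonneg)
    show "(\<lambda>x. (A + B * norm x) * \<bar>D x\<bar>) \<in> borel_measurable lborel"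
      unfolding D by measurable
  qed (use le_less_trans[OF le] W in auto)
  have "0 \<le> s * G * H * Q"
    using s G H Q by simp
  then have "(\<integral>x. (A + B * norm x) * \<bar>D x\<bar> \<partial>lborel) \<le> s * G * H * Q"
    using le W by (subst (asm) nn_integral_eq_integral[OF int]) auto
  with int show ?thesis by (simp add: Q_def)
qed

text \<open>The coefficients are left free so that \<open>u = 1\<close>, \<open>v = 0\<close> covers
  the first difference as well.\<close>

lemma measurable_integral_difference:
  assumes "ball_plan R \<gamma>"
  shows "(\<lambda>x. \<integral>p. k (x - interp t p) - u * k (x - interp 0 p) - v * k (x - interp 1 p) \<partial>\<gamma>) \<in> borel_measurable borel"
proof -
  interpret prob_space \<gamma> using assms by (simp add: ball_plan_def)
  have [measurable_cong]: "sets \<gamma> = sets (borel \<Otimes>\<^sub>M borel)"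
    using assms by (simp only: ball_plan_def borel_prod)
  show ?thesis unfolding interp_def by measurable
qed

lemma integrable_k_interp:
  assumes "ball_plan R \<gamma>"
  shows "integrable \<gamma> (\<lambda>p. k (x - interp t p))"
proof -
  have "interp t \<in> borel_measurable \<gamma>"
    using assms interp_measurable_plan by (auto simp: ball_plan_def)
  then show ?thesis
    using assms by (intro integrable_k) (auto simp: ball_plan_def)
qed

text \<open>The factors of the error have separate sources: \<open>s\<close> is the share of the
  mollified measure in the density, \<open>a\<^sup>2\<close> comes from two derivatives of the
  kernel, \<open>c\<close> is the averaged squared displacement, \<open>moment_bound\<close> is the
  logarithmic weight against a translated majorant, and \<open>\<alpha> * (1 - \<alpha>) / 2\<close>
  is the mass of Green's function.\<close>

lemma entropy_semiconvex:
  assumes \<gamma>: "ball_plan R \<gamma>" and cost: "transport_cost \<gamma> = ennreal c" and c: "0 \<le> c"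
    and \<alpha>: "0 \<le> \<alpha>" "\<alpha> \<le> 1"
  shows "ent (geodesic \<gamma> \<alpha>) \<le> (1 - \<alpha>) * ent (geodesic \<gamma> 0) + \<alpha> * ent (geodesic \<gamma> 1)
    + s * a\<^sup>2 * moment_bound M A B R * c / 2 * \<alpha> * (1 - \<alpha>)"
proof -
  have sets: "sets \<gamma> = sets borel" using \<gamma> by (simp add: ball_plan_def)
  have bp: "ball_prob R (geodesic \<gamma> t)" if "0 \<le> t" "t \<le> 1" for t
    using ball_prob_geodesic[OF \<gamma>] that by simp
  define d where "d t = dens (geodesic \<gamma> t)" for t
  define \<delta> where "\<delta> x p = k (x - interp \<alpha> p) - (1 - \<alpha>) * k (x - interp 0 p) - \<alpha> * k (x - interp 1 p)" for x p
  define D where "D x = d \<alpha> x - (1 - \<alpha>) * d 0 x - \<alpha> * d 1 x" for x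
  have D: "D x = s * (\<integral>p. \<delta> x p \<partial>\<gamma>)" for x
    unfolding D_def d_def dens_def \<delta>_def
    by (simp add: conv_geodesic[OF sets k_measurable] integrable_k_interp[OF \<gamma>] algebra_simps)
  have "(\<integral>\<^sup>+p. ennreal ((a * norm (fst p - snd p))\<^sup>2) \<partial>\<gamma>) = ennreal (a\<^sup>2) * transport_cost \<gamma>"
    unfolding transport_cost_def
    by (subst nn_integral_cmult[symmetric])
      (auto simp: measurable_cong_sets[OF sets refl] borel_prod[symmetric] power_mult_distrib ennreal_mult)
  then have H: "(\<integral>\<^sup>+p. ennreal ((a * norm (fst p - snd p))\<^sup>2) \<partial>\<gamma>) \<le> ennreal (a\<^sup>2 * c)"
    using c by (simp add: cost ennreal_mult)
  have "integrable lborel (\<lambda>x. (A + B * norm x) * \<bar>D x\<bar>) \<and>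
    (\<integral>x. (A + B * norm x) * \<bar>D x\<bar> \<partial>lborel) \<le> s * (\<alpha> * (1 - \<alpha>) / 2) * (a\<^sup>2 * c) * moment_bound M A B R"
  proof (rule weighted_difference[OF \<gamma> D _ _ _ _ _ _ _ _ _ H, where g = "green \<alpha>"])
    show "(\<lambda>p :: 'a \<times> 'a. (a * norm (fst p - snd p))\<^sup>2) \<in> borel_measurable borel"
      by (intro borel_measurable_continuous_onI continuous_intros)
    show "(\<lambda>x. \<integral>p. \<delta> x p \<partial>\<gamma>) \<in> borel_measurable borel"
      unfolding \<delta>_def by (rule measurable_integral_difference[OF \<gamma>])
    show "ennreal \<bar>\<delta> x p\<bar> \<le> (\<integral>\<^sup>+t. ennreal (green \<alpha> t * (a * norm (fst p - snd p))\<^sup>2 * M (x - interp t p)) \<partial>lborel)" for x p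
      unfolding \<delta>_def by (rule dominated_kernel_second_difference[OF kernel \<alpha>])
  qed (use green_nonneg[OF \<alpha>] green_outside[OF \<alpha>] c \<alpha> in \<open>auto simp: nn_integral_green\<close>)
  then have intD: "integrable lborel (\<lambda>x. (A + B * norm x) * \<bar>D x\<bar>)"
    and le': "(\<integral>x. (A + B * norm x) * \<bar>D x\<bar> \<partial>lborel) \<le> s * a\<^sup>2 * moment_bound M A B R * c / 2 * \<alpha> * (1 - \<alpha>)"
    by (auto simp: algebra_simps)
  have int: "integrable lborel (\<lambda>x. d t x * ln (d t x))" if "0 \<le> t" "t \<le> 1" for t
    unfolding d_def by (intro integrable_entropy bp that)
  have "(\<integral>x. d \<alpha> x * ln (d \<alpha> x) \<partial>lborel)
      \<le> (\<integral>x. (1 - \<alpha>) * (d 0 x * ln (d 0 x)) + \<alpha> * (d 1 x * ln (d 1 x)) + (A + B * norm x) * \<bar>D x\<bar> \<partial>lborel)"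
  proof (rule integral_mono)
    show "d \<alpha> x * ln (d \<alpha> x)
      \<le> (1 - \<alpha>) * (d 0 x * ln (d 0 x)) + \<alpha> * (d 1 x * ln (d 1 x)) + (A + B * norm x) * \<bar>D x\<bar>" for x
      unfolding D_def d_def
      by (intro xlnx_semiconvex dens_pos ln_dens_bound bp) (use \<alpha> in auto)
  qed (intro int intD \<alpha> Bochner_Integration.integrable_add integrable_mult_right; simp)+
  also have "\<dots> = (1 - \<alpha>) * (\<integral>x. d 0 x * ln (d 0 x) \<partial>lborel) + \<alpha> * (\<integral>x. d 1 x * ln (d 1 x) \<partial>lborel)
      + (\<integral>x. (A + B * norm x) * \<bar>D x\<bar> \<partial>lborel)"
    using int[of 0] int[of 1] intD by simp
  finally show ?thesis
    using le' by (simp add: ent_def d_def)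
qed

text \<open>Supplies the lower bound on the difference quotients. Only finiteness of the slope
  matters, so the displacement is bounded crudely by the diameter \<open>2 * R\<close>.\<close>

lemma entropy_lower_Lipschitz:
  assumes \<gamma>: "ball_plan R \<gamma>" and \<beta>: "\<beta> \<in> {0..1}"
  shows "ent (geodesic \<gamma> 0) - s * a * 2 * R * moment_bound M A B R * \<beta> \<le> ent (geodesic \<gamma> \<beta>)"
proof -
  interpret prob_space \<gamma> using \<gamma> by (simp add: ball_plan_def)
  have sets: "sets \<gamma> = sets borel" using \<gamma> by (simp add: ball_plan_def)
  have bp: "ball_prob R (geodesic \<gamma> t)" if "0 \<le> t" "t \<le> 1" for t
    using ball_prob_geodesic[OF \<gamma>] that by simp
  have \<beta>': "0 \<le> \<beta>" "\<beta> \<le> 1" using \<beta> by auto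
  define d where "d t = dens (geodesic \<gamma> t)" for t
  define \<delta> where "\<delta> x p = k (x - interp \<beta> p) - k (x - interp 0 p)" for x p
  define D where "D x = d \<beta> x - d 0 x" for x
  have D: "D x = s * (\<integral>p. \<delta> x p \<partial>\<gamma>)" for x
    unfolding D_def d_def dens_def \<delta>_def
    by (simp add: conv_geodesic[OF sets k_measurable] integrable_k_interp[OF \<gamma>] algebra_simps)
  have supp: "AE p in \<gamma>. norm (fst p) \<le> R \<and> norm (snd p) \<le> R"
    using \<gamma> by (simp add: ball_plan_def)
  have H: "(\<integral>\<^sup>+p. ennreal (a * norm (fst p - snd p)) \<partial>\<gamma>) \<le> ennreal (a * (2 * R))"
  proof -
    have "(\<integral>\<^sup>+p. ennreal (a * norm (fst p - snd p)) \<partial>\<gamma>) \<le> (\<integral>\<^sup>+p. ennreal (a * (2 * R)) \<partial>\<gamma>)"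
      using supp
    proof (intro nn_integral_mono_AE, eventually_elim)
      case (elim p)
      then have "norm (fst p - snd p) \<le> 2 * R"
        using norm_triangle_ineq4[of "fst p" "snd p"] by simp
      then show ?case using a by (intro ennreal_leI mult_left_mono)
    qed
    then show ?thesis
      by (simp add: emeasure_space_1)
  qed
  have "integrable lborel (\<lambda>x. (A + B * norm x) * \<bar>D x\<bar>) \<and>
    (\<integral>x. (A + B * norm x) * \<bar>D x\<bar> \<partial>lborel) \<le> s * \<beta> * (a * (2 * R)) * moment_bound M A B R"
  proof (rule weighted_difference[OF \<gamma> D _ _ _ _ _ _ _ _ _ H, where g = "indicator {0..\<beta>}"])
    show "(\<lambda>p :: 'a \<times> 'a. a * norm (fst p - snd p)) \<in> borel_measurable borel"
      by (intro borel_measurable_continuous_onI continuous_intros)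
    show "(\<lambda>x. \<integral>p. \<delta> x p \<partial>\<gamma>) \<in> borel_measurable borel"
      unfolding \<delta>_def using measurable_integral_difference[OF \<gamma>, of \<beta> 1 0] by simp
    show "ennreal \<bar>\<delta> x p\<bar> \<le> (\<integral>\<^sup>+t. ennreal (indicator {0..\<beta>} t * (a * norm (fst p - snd p)) * M (x - interp t p)) \<partial>lborel)" for x p
      unfolding \<delta>_def by (rule dominated_kernel_first_difference[OF kernel \<beta>'(1)])
    show "(\<integral>\<^sup>+t. ennreal (indicator {0..\<beta>} t) \<partial>lborel) \<le> ennreal \<beta>"
      using \<beta>' by (simp add: ennreal_indicator)
  qed (use \<beta>' a R in \<open>auto simp: indicator_def\<close>)
  then have intD: "integrable lborel (\<lambda>x. (A + B * norm x) * \<bar>D x\<bar>)"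
    and le': "(\<integral>x. (A + B * norm x) * \<bar>D x\<bar> \<partial>lborel) \<le> s * a * 2 * R * moment_bound M A B R * \<beta>"
    by (auto simp: algebra_simps)
  have int: "integrable lborel (\<lambda>x. d t x * ln (d t x))" if "0 \<le> t" "t \<le> 1" for t
    unfolding d_def by (intro integrable_entropy bp that)
  have "(\<integral>x. d 0 x * ln (d 0 x) - (A + B * norm x) * \<bar>D x\<bar> \<partial>lborel) \<le> (\<integral>x. d \<beta> x * ln (d \<beta> x) \<partial>lborel)"
  proof (rule integral_mono)
    fix x
    have "d 0 x * ln (d 0 x) + (1 + ln (d 0 x)) * D x \<le> d \<beta> x * ln (d \<beta> x)"
      unfolding D_def d_def by (intro xlnx_tangent dens_pos bp) (use \<beta>' in auto)
    moreover have "\<bar>(1 + ln (d 0 x)) * D x\<bar> \<le> (A + B * norm x) * \<bar>D x\<bar>"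
      unfolding abs_mult d_def by (intro mult_right_mono ln_dens_bound bp) auto
    ultimately show "d 0 x * ln (d 0 x) - (A + B * norm x) * \<bar>D x\<bar> \<le> d \<beta> x * ln (d \<beta> x)"
      by linarith
  qed (intro int intD \<beta>' Bochner_Integration.integrable_diff; simp)+
  also have "(\<integral>x. d 0 x * ln (d 0 x) - (A + B * norm x) * \<bar>D x\<bar> \<partial>lborel)
      = (\<integral>x. d 0 x * ln (d 0 x) \<partial>lborel) - (\<integral>x. (A + B * norm x) * \<bar>D x\<bar> \<partial>lborel)"
    using int[of 0] intD by simp
  finally show ?thesis
    using le' by (simp add: ent_def d_def)
qed

text \<open>\<open>K\<close> may be any upper bound of the natural constant, so that it can be
  rounded up to the form prescribed for \<lambda>.\<close>

lemma geodesic_semiconvexity: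
  assumes \<gamma>: "ball_plan R \<gamma>" and cost: "transport_cost \<gamma> = ennreal c" and c: "0 \<le> c"
    and K: "s * a\<^sup>2 * moment_bound M A B R * c \<le> K"
  shows "(\<exists>D. ((\<lambda>\<alpha>. ent (geodesic \<gamma> \<alpha>)) has_real_derivative D) (at_right 0) \<and>
      - (K / 2) \<le> ent (geodesic \<gamma> 1) - ent (geodesic \<gamma> 0) - D)"
    and "\<alpha> \<in> {0..1} \<Longrightarrow>
      ent (geodesic \<gamma> \<alpha>) \<le> (1 - \<alpha>) * ent (geodesic \<gamma> 0) + \<alpha> * ent (geodesic \<gamma> 1) + K / 2 * \<alpha> * (1 - \<alpha>)"
proof -
  have semi: "ent (geodesic \<gamma> (\<theta> * \<beta>)) \<le> (1 - \<theta>) * ent (geodesic \<gamma> 0) + \<theta> * ent (geodesic \<gamma> \<beta>)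
      + K / 2 * \<theta> * (1 - \<theta>) * \<beta>\<^sup>2" if \<theta>: "\<theta> \<in> {0..1}" and \<beta>: "\<beta> \<in> {0..1}" for \<theta> \<beta>
  proof -
    note tr = ball_plan_truncate[OF \<gamma> \<beta> cost]
    have "ent (geodesic \<gamma> (\<theta> * \<beta>)) \<le> (1 - \<theta>) * ent (geodesic \<gamma> 0) + \<theta> * ent (geodesic \<gamma> \<beta>)
        + s * a\<^sup>2 * moment_bound M A B R * (\<beta>\<^sup>2 * c) / 2 * \<theta> * (1 - \<theta>)"
      using entropy_semiconvex[OF tr(1,2), of \<theta>] c \<theta> by (simp add: tr(3))
    moreover have "s * a\<^sup>2 * moment_bound M A B R * c * (\<beta>\<^sup>2 / 2 * (\<theta> * (1 - \<theta>))) \<le> K * (\<beta>\<^sup>2 / 2 * (\<theta> * (1 - \<theta>)))"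
      using \<theta> by (intro mult_right_mono K) auto
    moreover have "s * a\<^sup>2 * moment_bound M A B R * (\<beta>\<^sup>2 * c) / 2 * \<theta> * (1 - \<theta>)
        = s * a\<^sup>2 * moment_bound M A B R * c * (\<beta>\<^sup>2 / 2 * (\<theta> * (1 - \<theta>)))"
      "K / 2 * \<theta> * (1 - \<theta>) * \<beta>\<^sup>2 = K * (\<beta>\<^sup>2 / 2 * (\<theta> * (1 - \<theta>)))"
      by simp_all
    ultimately show ?thesis by linarith
  qed
  have "0 \<le> s * a\<^sup>2 * moment_bound M A B R * c"
    using s c moment_bound_nonneg[OF M A B R] by simp
  then have "0 \<le> K / 2" using K by simp
  from semiconvex_imp_right_derivative[where f = "\<lambda>\<alpha>. ent (geodesic \<gamma> \<alpha>)" and \<kappa> = "K / 2"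
      and m = "s * a * 2 * R * moment_bound M A B R", OF semi entropy_lower_Lipschitz[OF \<gamma>] this]
  show "\<exists>D. ((\<lambda>\<alpha>. ent (geodesic \<gamma> \<alpha>)) has_real_derivative D) (at_right 0) \<and>
      - (K / 2) \<le> ent (geodesic \<gamma> 1) - ent (geodesic \<gamma> 0) - D"
    by simp
  show "ent (geodesic \<gamma> \<alpha>) \<le> (1 - \<alpha>) * ent (geodesic \<gamma> 0) + \<alpha> * ent (geodesic \<gamma> 1) + K / 2 * \<alpha> * (1 - \<alpha>)"
    if "\<alpha> \<in> {0..1}"
    using semi[OF that, of 1] by simp
qed

end

section \<open>Supports and optimal plans\<close>

text \<open>By second countability: the complement of the support is covered by the null sets of a
  countable basis.\<close>

lemma AE_in_supp:
  assumes "sets \<mu> = sets (borel :: 'a::euclidean_space measure)"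
  shows "AE x in \<mu>. x \<in> supp \<mu>"
proof -
  obtain \<B> :: "'a set set" where \<B>: "countable \<B>" "topological_basis \<B>"
    using ex_countable_basis by blast
  have "AE x in \<mu>. \<forall>b\<in>{b\<in>\<B>. emeasure \<mu> b = 0}. x \<notin> b"
  proof (subst AE_ball_countable)
    show "\<forall>b\<in>{b\<in>\<B>. emeasure \<mu> b = 0}. AE x in \<mu>. x \<notin> b"
    proof
      fix b assume "b \<in> {b\<in>\<B>. emeasure \<mu> b = 0}"
      then have "b \<in> null_sets \<mu>"
        using topological_basis_open[OF \<B>(2)] assms by (auto simp: null_sets_def)
      then show "AE x in \<mu>. x \<notin> b" by (rule AE_not_in)
    qed
  qed (use \<B> in auto)
  then show ?thesis
  proof eventually_elim
    case (elim x)
    show ?case unfolding supp_def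
    proof (intro CollectI allI impI)
      fix U :: "'a set" assume "open U" "x \<in> U"
      then obtain b where b: "b \<in> \<B>" "x \<in> b" "b \<subseteq> U"
        using topological_basisE[OF \<B>(2)] by blast
      then have "0 < emeasure \<mu> b" using elim zero_less_iff_neq_zero by blast
      also have "\<dots> \<le> emeasure \<mu> U"
        using b \<open>open U\<close> assms by (intro emeasure_mono) auto
      finally show "0 < emeasure \<mu> U" .
    qed
  qed
qed

lemma optimal_plan_ball:
  fixes \<gamma> :: "('a::euclidean_space \<times> 'a) measure"
  assumes P2: "\<rho>\<^sub>0 \<in> P2" "\<rho>\<^sub>1 \<in> P2" and supp: "supp \<rho>\<^sub>0 = cball 0 R\<^sub>0" "supp \<rho>\<^sub>1 = cball 0 R\<^sub>1"
    and opt: "optimal_plan \<gamma> \<rho>\<^sub>0 \<rho>\<^sub>1"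
  shows "ball_plan (max R\<^sub>0 R\<^sub>1) \<gamma>" "transport_cost \<gamma> = ennreal ((d\<^sub>W \<rho>\<^sub>0 \<rho>\<^sub>1)\<^sup>2)"
    "geodesic \<gamma> 0 = \<rho>\<^sub>0" "geodesic \<gamma> 1 = \<rho>\<^sub>1"
proof -
  have sets: "sets \<gamma> = sets borel" and fst: "distr \<gamma> borel fst = \<rho>\<^sub>0" and snd: "distr \<gamma> borel snd = \<rho>\<^sub>1"
    and c: "transport_cost \<gamma> = (INF \<gamma>'\<in>couplings \<rho>\<^sub>0 \<rho>\<^sub>1. transport_cost \<gamma>')"
    using opt by (auto simp: optimal_plan_def couplings_def)
  have m1: "fst \<in> measurable \<gamma> (borel :: 'a measure)" and m2: "snd \<in> measurable \<gamma> (borel :: 'a measure)"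
    unfolding measurable_cong_sets[OF sets refl]
    by (intro borel_measurable_continuous_onI continuous_intros)+
  \<comment> \<open>\<open>couplings\<close> does not mention total mass; it is inherited from the
    first marginal.\<close>
  interpret prob_space \<gamma>
    by (rule prob_space_distrD[OF m1]) (use P2 fst in \<open>simp add: P2_def\<close>)
  have "AE x in \<rho>\<^sub>0. norm x \<le> R\<^sub>0" "AE x in \<rho>\<^sub>1. norm x \<le> R\<^sub>1"
    using AE_in_supp[of \<rho>\<^sub>0] AE_in_supp[of \<rho>\<^sub>1] P2 supp by (auto simp: P2_def)
  then have "AE p in \<gamma>. norm (fst p) \<le> R\<^sub>0" "AE p in \<gamma>. norm (snd p) \<le> R\<^sub>1"
    unfolding fst[symmetric] snd[symmetric] by (auto dest: AE_distrD[OF m1] AE_distrD[OF m2])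
  then have AE: "AE p in \<gamma>. norm (fst p) \<le> max R\<^sub>0 R\<^sub>1 \<and> norm (snd p) \<le> max R\<^sub>0 R\<^sub>1"
    by eventually_elim auto
  then show "ball_plan (max R\<^sub>0 R\<^sub>1) \<gamma>"
    by (simp add: ball_plan_def sets prob_space_axioms)
  \<comment> \<open>Finiteness is essential: \<open>d\<^sub>W\<close> passes through
    \<open>enn2real\<close>, which sends an infinite cost to 0, so only a finite cost is recovered
    as the square of the distance.\<close>
  have "transport_cost \<gamma> \<le> (\<integral>\<^sup>+p. ennreal ((2 * max R\<^sub>0 R\<^sub>1)\<^sup>2) \<partial>\<gamma>)"
    unfolding transport_cost_def
    using AE
  proof (intro nn_integral_mono_AE, eventually_elim)
    case (elim p)
    then have "norm (fst p - snd p) \<le> 2 * max R\<^sub>0 R\<^sub>1"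
      using norm_triangle_ineq4[of "fst p" "snd p"] by linarith
    then show ?case by (intro ennreal_leI power_mono) auto
  qed
  also have "\<dots> < \<infinity>" by (simp add: emeasure_space_1)
  finally have "transport_cost \<gamma> < \<infinity>" .
  then show "transport_cost \<gamma> = ennreal ((d\<^sub>W \<rho>\<^sub>0 \<rho>\<^sub>1)\<^sup>2)"
    by (simp add: d\<^sub>W_def c[symmetric])
  show "geodesic \<gamma> 0 = \<rho>\<^sub>0" "geodesic \<gamma> 1 = \<rho>\<^sub>1"
    by (simp_all add: geodesic_def fst[symmetric] snd[symmetric])
qed

section \<open>Dilations of weights and kernels\<close>

text \<open>Change of variables \<open>\<epsilon> *\<^sub>R x\<close>: the Jacobian cancels the
  prefactor in \<open>rescale\<close>, so mass is preserved.\<close>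

lemma has_bochner_integral_rescale:
  fixes f :: "'a::euclidean_space \<Rightarrow> real"
  assumes f: "integrable lborel f" and \<epsilon>: "0 < \<epsilon>"
  shows "has_bochner_integral lborel (rescale f \<epsilon>) (\<integral>x. f x \<partial>lborel)"
proof -
  let ?D = "distr lborel borel (\<lambda>x :: 'a. \<epsilon> *\<^sub>R x)"
  have [measurable]: "f \<in> borel_measurable borel" using f by auto
  have [measurable]: "rescale f \<epsilon> \<in> borel_measurable borel"
    unfolding rescale_def[abs_def] by measurable
  have "has_bochner_integral (density ?D (\<lambda>_. ennreal (\<bar>\<epsilon>\<bar> ^ DIM('a)))) (rescale f \<epsilon>) (\<integral>x. f x \<partial>lborel)"
    unfolding has_bochner_integral_iff
  proof
    have eq: "rescale f \<epsilon> (\<epsilon> *\<^sub>R x) = f x / \<epsilon> ^ DIM('a)" for x :: 'a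
      using \<epsilon> by (simp add: rescale_def)
    show "integrable (density ?D (\<lambda>_. ennreal (\<bar>\<epsilon>\<bar> ^ DIM('a)))) (rescale f \<epsilon>)"
      by (subst integrable_density) (use \<epsilon> f eq in \<open>auto simp: integrable_distr_eq\<close>)
    show "integral\<^sup>L (density ?D (\<lambda>_. ennreal (\<bar>\<epsilon>\<bar> ^ DIM('a)))) (rescale f \<epsilon>) = (\<integral>x. f x \<partial>lborel)"
      by (subst integral_density) (use \<epsilon> f eq in \<open>auto simp: integral_distr\<close>)
  qed
  moreover have "density ?D (\<lambda>_. ennreal (\<bar>\<epsilon>\<bar> ^ DIM('a))) = lborel"
    using lborel_affine[of \<epsilon> "0 :: 'a"] \<epsilon> by simp
  ultimately show ?thesis by simp
qed

lemma norm_mult_rescale: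
  "0 < \<epsilon> \<Longrightarrow> norm x * rescale M \<epsilon> x = \<epsilon> * rescale (\<lambda>x. norm x * M x) \<epsilon> x"
  by (simp add: rescale_def)

lemma continuous_on_rescale:
  fixes f :: "'a::euclidean_space \<Rightarrow> real"
  assumes "continuous_on UNIV f"
  shows "continuous_on UNIV (rescale f \<epsilon>)"
proof -
  have "continuous_on UNIV (\<lambda>x :: 'a. inverse \<epsilon> *\<^sub>R x)"
    by (intro continuous_intros)
  then have "continuous_on UNIV (\<lambda>x. f (inverse \<epsilon> *\<^sub>R x))"
    by (rule continuous_on_compose2[OF assms]) simp
  then show ?thesis
    unfolding rescale_def[abs_def] divide_real_def by (rule continuous_on_mult_right)
qed

lemma integrable_weight_rescale:
  assumes M: "integrable_weight M" and \<epsilon>: "0 < \<epsilon>"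
  shows "integrable_weight (rescale M \<epsilon>)"
    and "moment_bound (rescale M \<epsilon>) A B R
      = (A + B * R) * (\<integral>x. M x \<partial>lborel) + B * \<epsilon> * (\<integral>x. norm x * M x \<partial>lborel)"
proof -
  note i = has_bochner_integral_rescale[OF integrable_weightD(3)[OF M] \<epsilon>]
    has_bochner_integral_rescale[OF integrable_weightD(4)[OF M] \<epsilon>]
  show "integrable_weight (rescale M \<epsilon>)"
    unfolding integrable_weight_def norm_mult_rescale[OF \<epsilon>]
    using i M \<epsilon> by (auto simp: integrable_weight_def continuous_on_rescale has_bochner_integral_iff)
      (simp add: rescale_def)
  show "moment_bound (rescale M \<epsilon>) A B R
      = (A + B * R) * (\<integral>x. M x \<partial>lborel) + B * \<epsilon> * (\<integral>x. norm x * M x \<partial>lborel)"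
    unfolding moment_bound_def norm_mult_rescale[OF \<epsilon>]
    using i by (simp add: has_bochner_integral_iff)
qed

text \<open>The derivative of the rescaled kernel in direction \<open>w\<close> is the rescaled
  derivative of \<open>V\<close> in direction \<open>w /\<^sub>R \<epsilon>\<close>. Hence each
  derivative costs \<open>1 / \<epsilon>\<close>, while the majorant keeps its integral.\<close>

lemma dominated_kernel_rescale:
  fixes V :: "'a::euclidean_space \<Rightarrow> real"
  assumes V: "dominated_kernel V 1 M" and \<epsilon>: "0 < \<epsilon>"
  shows "dominated_kernel (rescale V \<epsilon>) (1 / \<epsilon>) (rescale M \<epsilon>)"
proof -
  from V obtain V' V'' where
    1: "\<And>w y t. ((\<lambda>t. V (y + t *\<^sub>R w)) has_real_derivative V' w (y + t *\<^sub>R w)) (at t)"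
    and 2: "\<And>w y t. ((\<lambda>t. V' w (y + t *\<^sub>R w)) has_real_derivative V'' w (y + t *\<^sub>R w)) (at t)"
    and 3: "\<And>w. continuous_on UNIV (V'' w)"
    and 4: "\<And>w y. \<bar>V' w y\<bar> \<le> norm w * M y" "\<And>w y. \<bar>V'' w y\<bar> \<le> (norm w)\<^sup>2 * M y"
    and cont: "continuous_on UNIV V" and M: "integrable_weight M"
    and b: "bounded (range V)" and V0: "\<And>x. 0 \<le> V x" "\<And>x. V x \<le> M x"
    unfolding dominated_kernel_def mult_1 by blast
  obtain C where C: "\<And>x. norm (V x) \<le> C" using b unfolding bounded_iff by auto
  have d: "0 < \<epsilon> ^ DIM('a)" using \<epsilon> by simp
  have bd: "bounded (range (rescale V \<epsilon>))"
    unfolding bounded_iff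
    using C \<epsilon> by (intro exI[of _ "C / \<epsilon> ^ DIM('a)"]) (auto simp: rescale_def divide_right_mono)
  have le: "0 \<le> rescale V \<epsilon> x \<and> rescale V \<epsilon> x \<le> rescale M \<epsilon> x" for x
    using V0 \<epsilon> by (auto simp: rescale_def divide_right_mono)
  define k' where "k' w = rescale (V' (w /\<^sub>R \<epsilon>)) \<epsilon>" for w
  define k'' where "k'' w = rescale (V'' (w /\<^sub>R \<epsilon>)) \<epsilon>" for w
  have eq: "(y + t *\<^sub>R w) /\<^sub>R \<epsilon> = y /\<^sub>R \<epsilon> + t *\<^sub>R (w /\<^sub>R \<epsilon>)" for y w :: 'a and t
    by (simp add: algebra_simps)
  have "((\<lambda>t. rescale V \<epsilon> (y + t *\<^sub>R w)) has_real_derivative k' w (y + t *\<^sub>R w)) (at t)" for y w t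
    unfolding rescale_def k'_def eq by (rule DERIV_cdivide[OF 1])
  moreover have "((\<lambda>t. k' w (y + t *\<^sub>R w)) has_real_derivative k'' w (y + t *\<^sub>R w)) (at t)" for y w t
    unfolding rescale_def k'_def k''_def eq by (rule DERIV_cdivide[OF 2])
  moreover have "continuous_on UNIV (k'' w)" for w
    unfolding k''_def by (intro continuous_on_rescale 3)
  moreover have "\<bar>k' w y\<bar> \<le> 1 / \<epsilon> * norm w * rescale M \<epsilon> y" for w y
  proof -
    have "\<bar>k' w y\<bar> = \<bar>V' (w /\<^sub>R \<epsilon>) (y /\<^sub>R \<epsilon>)\<bar> / \<epsilon> ^ DIM('a)"
      using d by (simp add: k'_def rescale_def)
    also have "\<dots> \<le> norm (w /\<^sub>R \<epsilon>) * M (y /\<^sub>R \<epsilon>) / \<epsilon> ^ DIM('a)"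
      using d by (intro divide_right_mono 4) simp
    also have "\<dots> = 1 / \<epsilon> * norm w * rescale M \<epsilon> y"
      using \<epsilon> by (simp add: rescale_def divide_inverse)
    finally show ?thesis .
  qed
  moreover have "\<bar>k'' w y\<bar> \<le> (1 / \<epsilon> * norm w)\<^sup>2 * rescale M \<epsilon> y" for w y
  proof -
    have "\<bar>k'' w y\<bar> = \<bar>V'' (w /\<^sub>R \<epsilon>) (y /\<^sub>R \<epsilon>)\<bar> / \<epsilon> ^ DIM('a)"
      using d by (simp add: k''_def rescale_def)
    also have "\<dots> \<le> (norm (w /\<^sub>R \<epsilon>))\<^sup>2 * M (y /\<^sub>R \<epsilon>) / \<epsilon> ^ DIM('a)"
      using d by (intro divide_right_mono 4) simp
    also have "\<dots> = (1 / \<epsilon> * norm w)\<^sup>2 * rescale M \<epsilon> y"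
      using \<epsilon> by (simp add: rescale_def divide_inverse)
    finally show ?thesis .
  qed
  ultimately show ?thesis
    unfolding dominated_kernel_def
    using integrable_weight_rescale(1)[OF M \<epsilon>] continuous_on_rescale[OF cont] bd le
    by (intro conjI exI[of _ k'] exI[of _ k'']) auto
qed

section \<open>The kernels\<close>

text \<open>Layer-cake argument: writing \<open>exp (- norm x)\<close> as the integral of
  \<open>exp (- t)\<close> over \<open>t \<ge> norm x\<close> and exchanging integrals leaves the
  volume of the ball of radius \<open>t\<close> against \<open>exp (- t)\<close>, which is a Gamma
  integral.\<close>

lemma integrable_exp_neg_norm: "integrable lborel (\<lambda>x :: 'a::euclidean_space. exp (- norm x))"
proof (rule integrableI_nonneg)
  let ?d = "DIM('a)"
  have "(\<integral>\<^sup>+x. ennreal (exp (- norm (x :: 'a))) \<partial>lborel)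
      = (\<integral>\<^sup>+x. \<integral>\<^sup>+t. ennreal (exp (- t)) * indicator {norm (x :: 'a)..} t \<partial>lborel \<partial>lborel)"
  proof (intro nn_integral_cong)
    fix x :: 'a
    have "(\<integral>\<^sup>+t. ennreal (exp (- t)) * indicator {norm x..} t \<partial>lborel) = ennreal (0 - (- exp (- norm x)))"
    proof (rule nn_integral_FTC_atLeast)
      show "((\<lambda>t :: real. - exp (- t)) \<longlongrightarrow> 0) at_top"
        using tendsto_minus[OF filterlim_compose[OF exp_at_bot filterlim_uminus_at_bot_at_top]] by simp
    qed (auto intro!: derivative_eq_intros)
    then show "ennreal (exp (- norm x)) = (\<integral>\<^sup>+t. ennreal (exp (- t)) * indicator {norm x..} t \<partial>lborel)"
      by simp
  qed
  also have "\<dots> = (\<integral>\<^sup>+x. \<integral>\<^sup>+t. ennreal (exp (- t)) * indicator {p. norm (fst p) \<le> snd p} (x :: 'a, t) \<partial>lborel \<partial>lborel)"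
    by (intro nn_integral_cong) (auto simp: indicator_def)
  also have "\<dots> = (\<integral>\<^sup>+t. \<integral>\<^sup>+x. ennreal (exp (- t)) * indicator {p. norm (fst p) \<le> snd p} (x :: 'a, t) \<partial>lborel \<partial>lborel)"
    by (rule lborel_pair.Fubini') measurable
  also have "\<dots> = (\<integral>\<^sup>+t. ennreal (exp (- t)) * emeasure lborel (cball (0 :: 'a) t) \<partial>lborel)"
  proof (intro nn_integral_cong)
    fix t :: real
    have "(\<integral>\<^sup>+x. ennreal (exp (- t)) * indicator {p. norm (fst p) \<le> snd p} (x :: 'a, t) \<partial>lborel)
      = (\<integral>\<^sup>+x. ennreal (exp (- t)) * indicator (cball 0 t) (x :: 'a) \<partial>lborel)"
      by (intro nn_integral_cong) (auto simp: indicator_def)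
    then show "(\<integral>\<^sup>+x. ennreal (exp (- t)) * indicator {p. norm (fst p) \<le> snd p} (x :: 'a, t) \<partial>lborel)
      = ennreal (exp (- t)) * emeasure lborel (cball (0 :: 'a) t)"
      by (simp add: nn_integral_cmult_indicator)
  qed
  also have "\<dots> = (\<integral>\<^sup>+t. ennreal (unit_ball_vol ?d) * (ennreal (t ^ ?d * exp (- t)) * indicator {0..} t) \<partial>lborel)"
  proof (intro nn_integral_cong)
    fix t :: real
    show "ennreal (exp (- t)) * emeasure lborel (cball (0 :: 'a) t)
      = ennreal (unit_ball_vol ?d) * (ennreal (t ^ ?d * exp (- t)) * indicator {0..} t)"
      by (cases "0 \<le> t") (simp_all add: emeasure_cball ennreal_mult[symmetric] mult_ac)
  qed
  also have "\<dots> = ennreal (unit_ball_vol ?d) * ennreal (fact ?d)"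
    by (subst nn_integral_cmult) (simp_all add: nn_intergal_power_times_exp_Ici)
  also have "\<dots> < \<infinity>"
    by (simp add: ennreal_mult_less_top)
  finally show "(\<integral>\<^sup>+x. ennreal (exp (- norm (x :: 'a))) \<partial>lborel) < \<infinity>" .
qed auto

section \<open>The bracket and its exponential kernel\<close>

lemma bracket_ge_1: "1 \<le> bracket x"
  and bracket_pos: "0 < bracket x"
  and norm_le_bracket: "norm x \<le> bracket x"
  and bracket_le: "bracket x \<le> 1 + norm x"
proof -
  show "1 \<le> bracket x" by (simp add: bracket_def)
  then show "0 < bracket x" by simp
  show "norm x \<le> bracket x" unfolding bracket_def by (rule real_le_rsqrt) simp
  show "bracket x \<le> 1 + norm x"
    unfolding bracket_def by (rule real_le_lsqrt) (auto simp: power2_eq_square algebra_simps)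
qed

lemma continuous_on_bracket: "continuous_on UNIV (bracket :: 'a::euclidean_space \<Rightarrow> real)"
  unfolding bracket_def[abs_def] by (intro continuous_intros)

lemma bracket_measurable [measurable]: "(bracket :: 'a::euclidean_space \<Rightarrow> real) \<in> borel_measurable borel"
  by (rule borel_measurable_continuous_onI[OF continuous_on_bracket])

definition Z1 :: "'a::euclidean_space itself \<Rightarrow> real" where
  "Z1 _ = (\<integral>y. exp (- bracket (y::'a)) \<partial>lborel)"

lemma N1_eq: "N1 (x::'a::euclidean_space) = exp (- bracket x) / Z1 TYPE('a)"
  by (simp add: N1_def Z1_def)

lemma integrable_exp_bracket: "integrable lborel (\<lambda>x :: 'a::euclidean_space. exp (- bracket x))"
  by (rule Bochner_Integration.integrable_bound[OF integrable_exp_neg_norm])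
    (use norm_le_bracket in auto)

lemma Z1_pos: "0 < Z1 TYPE('a::euclidean_space)"
proof -
  have "Z1 TYPE('a) \<noteq> 0"
  proof
    assume "Z1 TYPE('a) = 0"
    then have "AE x :: 'a in lborel. exp (- bracket x) = 0"
      unfolding Z1_def by (subst (asm) integral_nonneg_eq_0_iff_AE[OF integrable_exp_bracket]) auto
    then have "emeasure (lborel :: 'a measure) UNIV = 0"
      by (simp add: AE_iff_measurable[OF _ refl])
    then show False by simp
  qed
  moreover have "0 \<le> Z1 TYPE('a)"
    unfolding Z1_def by (intro integral_nonneg_AE) simp
  ultimately show ?thesis by simp
qed

lemma N1_pos: "0 < N1 x"
  by (simp add: N1_eq Z1_pos)

lemma N1_le: "N1 (x :: 'a::euclidean_space) \<le> 1 / Z1 TYPE('a)"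
  using bracket_pos[of x] Z1_pos[where 'a='a] by (simp add: N1_eq divide_right_mono less_imp_le)

lemma integrable_weight_N1: "integrable_weight (N1 :: 'a::euclidean_space \<Rightarrow> real)"
proof -
  have cont: "continuous_on UNIV (N1 :: 'a \<Rightarrow> real)"
    unfolding N1_eq[abs_def] using Z1_pos[where 'a='a]
    by (intro continuous_intros continuous_on_bracket) auto
  \<comment> \<open>Half of the exponential decay is spent on the factor \<open>norm x\<close>, by
    \<open>norm x \<le> 2 * exp (norm x / 2)\<close>. The remaining majorant is the exponential
    dilated by 2, with \<open>2 ^ DIM('a)\<close> undoing the prefactor of
    \<open>rescale\<close>.\<close>
  have "integrable lborel (\<lambda>x :: 'a. 2 * (2 ^ DIM('a) * rescale (\<lambda>x. exp (- norm x)) 2 x))"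
    using has_bochner_integral_rescale[OF integrable_exp_neg_norm[where 'a='a], of 2]
    by (intro integrable_mult_right) (auto simp: has_bochner_integral_iff)
  then have int: "integrable lborel (\<lambda>x :: 'a. 2 * exp (- norm x / 2))"
    by (simp add: rescale_def)
  have "integrable lborel (\<lambda>x :: 'a. norm x * exp (- bracket x))"
  proof (rule Bochner_Integration.integrable_bound[OF int])
    show "AE x :: 'a in lborel. norm (norm x * exp (- bracket x)) \<le> norm (2 * exp (- norm x / 2))"
    proof (intro AE_I2)
      fix x :: 'a
      have "norm x / 2 \<le> exp (norm x / 2)"
        using exp_ge_add_one_self[of "norm x / 2"] by linarith
      then have "norm x * exp (- norm x) \<le> (2 * exp (norm x / 2)) * exp (- norm x)"
        by (intro mult_right_mono) auto
      also have "\<dots> = 2 * exp (- norm x / 2)"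
        by (simp add: mult_exp_exp field_simps)
      finally have "norm x * exp (- norm x) \<le> 2 * exp (- norm x / 2)" .
      moreover have "norm x * exp (- bracket x) \<le> norm x * exp (- norm x)"
        using norm_le_bracket by (intro mult_left_mono) auto
      ultimately show "norm (norm x * exp (- bracket x)) \<le> norm (2 * exp (- norm x / 2))" by simp
    qed
  qed measurable
  then have "integrable lborel (\<lambda>x :: 'a. norm x * exp (- bracket x) / Z1 TYPE('a))" by simp
  then show ?thesis
    unfolding integrable_weight_def using cont integrable_exp_bracket Z1_pos[where 'a='a]
    by (auto simp: N1_eq[abs_def] less_imp_le)
qed

text \<open>The kernel dominates its own derivatives because \<open>bracket\<close> has slope at
  most 1 and its second derivative in direction \<open>w\<close> lies between 0 and
  \<open>(norm w)\<^sup>2\<close>; in \<open>k''\<close> the latter is the subtracted quotient by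
  \<open>bracket x\<close>.\<close>

lemma dominated_kernel_N1: "dominated_kernel (N1 :: 'a::euclidean_space \<Rightarrow> real) 1 N1"
proof -
  define k' where "k' w x = - N1 x * ((x \<bullet> w) / bracket x)" for w x :: 'a
  define k'' where "k'' w x = N1 x * (((x \<bullet> w) / bracket x)\<^sup>2 - ((norm w)\<^sup>2 - ((x \<bullet> w) / bracket x)\<^sup>2) / bracket x)" for w x :: 'a
  have b: "((\<lambda>t. bracket (y + t *\<^sub>R w)) has_real_derivative ((y + t *\<^sub>R w) \<bullet> w) / bracket (y + t *\<^sub>R w)) (at t)"
    for y w :: 'a and t
  proof -
    have eq: "bracket (y + t *\<^sub>R w) = sqrt (1 + (y \<bullet> y + 2 * t * (y \<bullet> w) + t\<^sup>2 * (w \<bullet> w)))" for t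
      unfolding bracket_def power2_norm_eq_inner
      by (simp add: inner_add_left inner_add_right inner_commute power2_eq_square algebra_simps)
    have pos: "0 < 1 + (y \<bullet> y + 2 * t * (y \<bullet> w) + t\<^sup>2 * (w \<bullet> w))"
      using bracket_pos[of "y + t *\<^sub>R w"] unfolding eq by simp
    show ?thesis unfolding eq
      using pos by (auto intro!: derivative_eq_intros simp: inner_add_left divide_simps power2_eq_square)
  qed
  have ip: "((\<lambda>t. (y + t *\<^sub>R w) \<bullet> w) has_real_derivative (norm w)\<^sup>2) (at t)" for y w :: 'a and t
    unfolding inner_add_left inner_scaleR_left power2_norm_eq_inner
    by (auto intro!: derivative_eq_intros)
  have nz: "bracket x \<noteq> 0" for x :: 'a using bracket_pos[of x] by simp
  have 1: "((\<lambda>t. N1 (y + t *\<^sub>R w)) has_real_derivative k' w (y + t *\<^sub>R w)) (at t)" for y w :: 'a and t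
    unfolding k'_def N1_eq using Z1_pos[where 'a='a]
    by (auto intro!: derivative_eq_intros b)
  have 2: "((\<lambda>t. k' w (y + t *\<^sub>R w)) has_real_derivative k'' w (y + t *\<^sub>R w)) (at t)" for y w :: 'a and t
    unfolding k'_def
    by (rule derivative_eq_intros 1 b ip nz refl)+
      (use nz[of "y + t *\<^sub>R w"] in \<open>simp add: k'_def k''_def field_simps power2_eq_square\<close>)
  have 3: "continuous_on UNIV (k'' w)" for w
    unfolding k''_def using integrable_weight_N1[where 'a='a, unfolded integrable_weight_def] nz
    by (intro continuous_intros continuous_on_bracket) auto
  have q: "\<bar>(x \<bullet> w) / bracket x\<bar> \<le> norm w" for x w :: 'a
  proof -
    have "\<bar>x \<bullet> w\<bar> \<le> norm x * norm w" by (rule Cauchy_Schwarz_ineq2)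
    also have "\<dots> \<le> bracket x * norm w" by (intro mult_right_mono norm_le_bracket) simp
    finally show ?thesis using bracket_pos[of x] by (simp add: abs_div pos_divide_le_eq mult.commute)
  qed
  have 4: "\<bar>k' w x\<bar> \<le> 1 * norm w * N1 x" for w x
    using mult_left_mono[OF q[of x w], of "N1 x"] N1_pos[of x]
    by (simp add: k'_def abs_mult mult.commute)
  have 5: "\<bar>k'' w x\<bar> \<le> (1 * norm w)\<^sup>2 * N1 x" for w x
  proof -
    \<comment> \<open>Both \<open>r\<close> and the subtracted quotient lie between 0 and
      \<open>(norm w)\<^sup>2\<close>, hence so does the absolute value of their difference;
      bounding the two terms separately would lose a factor 2.\<close>
    define r where "r = ((x \<bullet> w) / bracket x)\<^sup>2"
    have r: "0 \<le> r" "r \<le> (norm w)\<^sup>2"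
      unfolding r_def using power_mono[OF q[of x w], of 2] by (auto simp only: power2_abs abs_ge_zero zero_le_power2)
    have "((norm w)\<^sup>2 - r) / bracket x \<le> ((norm w)\<^sup>2 - r) / 1"
      using r bracket_ge_1[of x] by (intro divide_left_mono) auto
    moreover have "0 \<le> ((norm w)\<^sup>2 - r) / bracket x"
      using r bracket_pos[of x] by simp
    ultimately have "\<bar>r - ((norm w)\<^sup>2 - r) / bracket x\<bar> \<le> (norm w)\<^sup>2"
      using r by simp
    then show ?thesis
      using mult_left_mono[of _ _ "N1 x"] N1_pos[of x]
      by (simp add: k''_def r_def abs_mult mult.commute)
  qed
  have "bounded (range (N1 :: 'a \<Rightarrow> real))"
    unfolding bounded_iff by (intro exI[of _ "1 / Z1 TYPE('a)"]) (auto simp: abs_of_pos[OF N1_pos] N1_le)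
  then show ?thesis
    unfolding dominated_kernel_def
    using integrable_weight_N1[where 'a='a] 1 2 3 4 5
    by (intro conjI exI[of _ k'] exI[of _ k''])
      (auto simp: integrable_weight_def less_imp_le[OF N1_pos] simp del: mult_1)
qed

text \<open>The majorant is the sum of \<open>V\<close> and the operator norms of its two
  derivatives. Off the support \<open>V\<close> vanishes on an open set, so the derivatives vanish
  there too; the majorant is continuous with compact support and has finite moments determined by
  \<open>V\<close>.\<close>

lemma dominated_kernel_C2c:
  fixes V :: "'a::euclidean_space \<Rightarrow> real"
  assumes V: "kernel_V1 V" "C2c V"
  shows "\<exists>M. dominated_kernel V 1 M"
proof -
  from V obtain f' f'' where
    f': "\<And>x. (V has_derivative blinfun_apply (f' x)) (at x)"
    and f'': "\<And>x. (f' has_derivative blinfun_apply (f'' x)) (at x)" and cont'': "continuous_on UNIV f''"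
    unfolding C2c_def C2_map_def C1_map_def by blast
  have cont: "continuous_on UNIV V" and V0: "\<And>x. 0 \<le> V x" and bd: "bounded (range V)"
    using V(1) by (auto simp: kernel_V1_def)
  have cont': "continuous_on UNIV f'"
    using f'' by (intro has_derivative_continuous_on) auto
  define M where "M x = V x + norm (f' x) + norm (f'' x)" for x
  define S where "S = closure {x. V x \<noteq> 0}"
  have S: "compact S" using V(2) by (simp add: C2c_def S_def)
  then have openS: "open (- S)" by (simp add: compact_imp_closed open_Compl)
  have V_out: "V x = 0" if "x \<in> - S" for x
    using that closure_subset[of "{x. V x \<noteq> 0}"] unfolding S_def by auto
  have f'_out: "f' x = 0" if x: "x \<in> - S" for x
  proof -
    have "(V has_derivative (\<lambda>_. 0)) (at x)"
      by (rule has_derivative_transform_within_open[OF has_derivative_const[of 0] openS x]) (simp add: V_out)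
    from has_derivative_unique[OF this f'] show ?thesis
      by (intro blinfun_eqI) (simp add: fun_eq_iff)
  qed
  have f''_out: "f'' x = 0" if x: "x \<in> - S" for x
  proof -
    have "(f' has_derivative (\<lambda>_. 0)) (at x)"
      by (rule has_derivative_transform_within_open[OF has_derivative_const[of 0] openS x]) (simp add: f'_out)
    from has_derivative_unique[OF this f''] show ?thesis
      by (intro blinfun_eqI) (simp add: fun_eq_iff)
  qed
  have contM: "continuous_on UNIV M"
    unfolding M_def by (intro continuous_intros cont cont' cont'')
  have int: "integrable lborel g" if "continuous_on UNIV g" "\<And>x. x \<in> - S \<Longrightarrow> g x = 0" for g :: "'a \<Rightarrow> real"
  proof -
    have "integrable lborel (\<lambda>x. indicator S x *\<^sub>R g x)"
      using that(1) continuous_on_subset by (intro borel_integrable_compact[OF S]) blast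
    also have "(\<lambda>x. indicator S x *\<^sub>R g x) = g"
      using that(2) by (intro ext) (auto simp: indicator_def)
    finally show ?thesis .
  qed
  have wM: "integrable_weight M"
    unfolding integrable_weight_def
  proof (intro conjI contM int)
    show "continuous_on UNIV (\<lambda>x. norm x * M x)"
      by (intro continuous_intros contM)
  qed (auto simp: M_def V_out f'_out f''_out V0)
  define k' where "k' w x = blinfun_apply (f' x) w" for w x
  define k'' where "k'' w x = blinfun_apply (blinfun_apply (f'' x) w) w" for w x
  have line: "((\<lambda>t. y + t *\<^sub>R w) has_derivative (\<lambda>h. h *\<^sub>R w)) (at t)" for y w :: 'a and t :: real
    by (auto intro!: derivative_eq_intros)
  have 1: "((\<lambda>t. V (y + t *\<^sub>R w)) has_real_derivative k' w (y + t *\<^sub>R w)) (at t)" for y w t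
    unfolding has_field_derivative_def
    using has_derivative_compose[OF line f', of y w t]
    by (simp add: k'_def blinfun.scaleR_right mult.commute[of _ "blinfun_apply _ _"] fun_eq_iff)
  have 2: "((\<lambda>t. k' w (y + t *\<^sub>R w)) has_real_derivative k'' w (y + t *\<^sub>R w)) (at t)" for y w t
  proof -
    have "((\<lambda>t. blinfun_apply (f' (y + t *\<^sub>R w)) w) has_derivative
        (\<lambda>h. blinfun_apply (blinfun_apply (f'' (y + t *\<^sub>R w)) (h *\<^sub>R w)) w)) (at t)"
      using bounded_linear.has_derivative[OF blinfun.bounded_linear_left has_derivative_compose[OF line f'']] by blast
    then show ?thesis
      unfolding has_field_derivative_def k'_def k''_def
      by (simp add: blinfun.scaleR_right blinfun.scaleR_left mult.commute[of _ "blinfun_apply _ _"])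
  qed
  have 3: "continuous_on UNIV (k'' w)" for w
    unfolding k''_def by (intro continuous_intros cont'')
  have 4: "\<bar>k' w y\<bar> \<le> 1 * norm w * M y" for w y
  proof -
    have "\<bar>k' w y\<bar> \<le> norm (f' y) * norm w"
      unfolding k'_def using norm_blinfun[of "f' y" w] by simp
    also have "\<dots> \<le> M y * norm w"
      by (intro mult_right_mono) (auto simp: M_def V0)
    finally show ?thesis by (simp add: mult.commute)
  qed
  have 5: "\<bar>k'' w y\<bar> \<le> (1 * norm w)\<^sup>2 * M y" for w y
  proof -
    have "\<bar>k'' w y\<bar> \<le> norm (blinfun_apply (f'' y) w) * norm w"
      unfolding k''_def using norm_blinfun[of "blinfun_apply (f'' y) w" w] by simp
    also have "\<dots> \<le> (norm (f'' y) * norm w) * norm w"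
      by (intro mult_right_mono norm_blinfun) simp
    also have "\<dots> = norm (f'' y) * (norm w)\<^sup>2"
      by (simp add: power2_eq_square)
    also have "\<dots> \<le> M y * (norm w)\<^sup>2"
      by (intro mult_right_mono) (auto simp: M_def V0)
    finally show ?thesis by (simp add: mult.commute)
  qed
  have "V x \<le> M x" for x by (simp add: M_def)
  then have "dominated_kernel V 1 M"
    unfolding dominated_kernel_def using wM cont bd V0 1 2 3 4 5
    by (intro conjI exI[of _ k'] exI[of _ k'']) (auto simp del: mult_1)
  then show ?thesis by blast
qed

section \<open>Logarithmic bounds and constants\<close>

text \<open>Optimality enters here: the cost of the plan is exactly the squared distance, so a
  constant multiplying the cost becomes the modulus of convexity \<open>l\<close>, with opposite
  sign.\<close>

lemma geodesic_inequalities: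
  fixes V :: "'a::euclidean_space \<Rightarrow> real" and \<gamma> :: "('a \<times> 'a) measure"
  assumes reg: "regularized_entropy (rescale V \<epsilon>) M (\<lambda>x. \<sigma> * N1 x) a (1 - \<sigma>) (max R\<^sub>0 R\<^sub>1) A B"
    and plan: "\<rho>\<^sub>0 \<in> P2" "\<rho>\<^sub>1 \<in> P2" "supp \<rho>\<^sub>0 = cball 0 R\<^sub>0" "supp \<rho>\<^sub>1 = cball 0 R\<^sub>1"
      "optimal_plan \<gamma> \<rho>\<^sub>0 \<rho>\<^sub>1"
    and l: "(1 - \<sigma>) * a\<^sup>2 * moment_bound M A B (max R\<^sub>0 R\<^sub>1) \<le> - l"
  shows "(\<exists>D. ((\<lambda>\<alpha>. entropy_reg V \<epsilon> \<sigma> (geodesic \<gamma> \<alpha>)) has_real_derivative D) (at_right 0) \<and>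
      entropy_reg V \<epsilon> \<sigma> \<rho>\<^sub>1 - entropy_reg V \<epsilon> \<sigma> \<rho>\<^sub>0 - D \<ge> l / 2 * (d\<^sub>W \<rho>\<^sub>0 \<rho>\<^sub>1)\<^sup>2) \<and>
    convex_along l (entropy_reg V \<epsilon> \<sigma>) (geodesic \<gamma>)"
proof -
  interpret regularized_entropy "rescale V \<epsilon>" M "\<lambda>x. \<sigma> * N1 x" a "1 - \<sigma>" "max R\<^sub>0 R\<^sub>1" A B
    by fact
  have H: "entropy_reg V \<epsilon> \<sigma> = ent"
    by (simp add: fun_eq_iff entropy_reg_def ent_def dens_def Let_def)
  note plan' = optimal_plan_ball[OF plan]
  define w where "w = (d\<^sub>W \<rho>\<^sub>0 \<rho>\<^sub>1)\<^sup>2"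
  have w: "0 \<le> w" by (simp add: w_def)
  have "(1 - \<sigma>) * a\<^sup>2 * moment_bound M A B (max R\<^sub>0 R\<^sub>1) * w \<le> - l * w"
    by (intro mult_right_mono l w)
  note main = geodesic_semiconvexity[OF plan'(1) plan'(2)[folded w_def] w this]
  show ?thesis
    using main(1) main(2)
    by (auto simp: H convex_along_def plan'(3,4) w_def[symmetric] algebra_simps)
qed

lemma conv_bounds:
  assumes \<rho>: "prob_space \<rho>" "sets \<rho> = sets borel" and k: "continuous_on UNIV k"
    and lo: "AE y in \<rho>. lo \<le> k (x - y)" and hi: "\<And>x. k x \<le> hi" and k0: "\<And>x. 0 \<le> k x"
  shows "lo \<le> conv k \<rho> x" "conv k \<rho> x \<le> hi"
proof -
  interpret prob_space \<rho> by fact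
  note [measurable_cong] = \<rho>(2)
  have [measurable]: "k \<in> borel_measurable borel"
    by (rule borel_measurable_continuous_onI[OF k])
  have int: "integrable \<rho> (\<lambda>y. k (x - y))"
    using hi k0 by (intro integrable_const_bound[where B = hi]) auto
  show "lo \<le> conv k \<rho> x" "conv k \<rho> x \<le> hi"
    unfolding conv_def using hi
    by (auto intro!: integral_ge_const[OF int lo] integral_le_const[OF int])
qed

text \<open>From below, \<open>u\<close> is at least \<open>\<sigma> * N1 x\<close>, whose logarithm
  falls with slope at most 1 in \<open>norm x\<close>; from above, the mollified measure is at most
  the supremum of the rescaled kernel.\<close>

lemma log_bound_regularized:
  fixes V :: "'a::euclidean_space \<Rightarrow> real" and x :: 'a
  assumes V: "continuous_on UNIV V" "\<And>x. 0 \<le> V x" "\<And>x. V x \<le> S" and S: "0 < S"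
    and \<epsilon>: "0 < \<epsilon>" and \<sigma>: "\<sigma> \<in> {0<..<1}" and \<rho>: "prob_space \<rho>" "sets \<rho> = sets borel"
  defines "u \<equiv> (1 - \<sigma>) * conv (rescale V \<epsilon>) \<rho> x + \<sigma> * N1 x" and "Z \<equiv> Z1 TYPE('a)"
  shows "0 < u"
    and "\<bar>1 + ln u\<bar> \<le> 3 + \<bar>ln Z\<bar> + \<bar>ln (S + 1 / Z)\<bar> + (\<bar>ln \<sigma>\<bar> + DIM('a) * \<bar>ln \<epsilon>\<bar>) + 1 * norm x"
proof -
  have Z: "0 < Z" unfolding Z_def by (rule Z1_pos)
  have d: "0 < \<epsilon> ^ DIM('a)" using \<epsilon> by simp
  have conv: "0 \<le> conv (rescale V \<epsilon>) \<rho> x" "conv (rescale V \<epsilon>) \<rho> x \<le> S / \<epsilon> ^ DIM('a)"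
    using V d by (intro conv_bounds[OF \<rho>, where lo = 0 and hi = "S / \<epsilon> ^ DIM('a)"];
      simp add: continuous_on_rescale; simp add: rescale_def divide_right_mono)+
  have N: "\<sigma> * N1 x \<le> u" "0 < \<sigma> * N1 x"
    using conv \<sigma> N1_pos[of x] by (auto simp: u_def)
  then show pos: "0 < u" by simp
  have "ln (\<sigma> * N1 x) = ln \<sigma> - bracket x - ln Z"
    using \<sigma> Z by (simp add: N1_eq ln_mult ln_div Z_def)
  moreover have "ln (\<sigma> * N1 x) \<le> ln u"
    using N pos by (subst ln_le_cancel_iff) auto
  ultimately have lower: "ln \<sigma> - (1 + norm x) - ln Z \<le> ln u"
    using bracket_le[of x] by linarith
  \<comment> \<open>\<open>E\<close> dominates both 1 and \<open>1 / \<epsilon> ^ DIM('a)\<close>,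
    for \<open>\<epsilon>\<close> on either side of 1, so it can be factored out before taking the
    logarithm.\<close>
  define E where "E = exp (DIM('a) * \<bar>ln \<epsilon>\<bar>)"
  have E1: "1 \<le> E" by (simp add: E_def)
  have "1 / \<epsilon> ^ DIM('a) = exp (DIM('a) * (- ln \<epsilon>))"
    using \<epsilon> by (simp add: exp_minus exp_of_nat_mult divide_inverse)
  also have "\<dots> \<le> E"
    unfolding E_def exp_le_cancel_iff by (intro mult_left_mono) auto
  finally have E2: "1 / \<epsilon> ^ DIM('a) \<le> E" .
  have "u \<le> 1 * (S / \<epsilon> ^ DIM('a)) + 1 * (1 / Z)"
    unfolding u_def using conv \<sigma> N1_le[of x] N1_pos[of x]
    by (intro add_mono mult_mono) (auto simp: Z_def less_imp_le)
  also have "\<dots> = S * (1 / \<epsilon> ^ DIM('a)) + (1 / Z) * 1"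
    by simp
  also have "\<dots> \<le> S * E + (1 / Z) * E"
    using S Z E1 E2 by (intro add_mono mult_left_mono) auto
  also have "\<dots> = E * (S + 1 / Z)"
    by (simp add: algebra_simps)
  finally have "ln u \<le> ln (E * (S + 1 / Z))"
    using pos by (intro ln_mono) auto
  also have "\<dots> = DIM('a) * \<bar>ln \<epsilon>\<bar> + ln (S + 1 / Z)"
    using add_pos_pos[OF S divide_pos_pos[OF zero_less_one Z]] by (subst ln_mult) (auto simp: E_def)
  finally have upper: "ln u \<le> DIM('a) * \<bar>ln \<epsilon>\<bar> + ln (S + 1 / Z)" .
  have "0 \<le> DIM('a) * \<bar>ln \<epsilon>\<bar>" by simp
  moreover have "0 \<le> norm x" by simp
  ultimately show "\<bar>1 + ln u\<bar> \<le> 3 + \<bar>ln Z\<bar> + \<bar>ln (S + 1 / Z)\<bar> + (\<bar>ln \<sigma>\<bar> + DIM('a) * \<bar>ln \<epsilon>\<bar>) + 1 * norm x"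
    using lower upper by linarith
qed

text \<open>Every \<open>y\<close> in the ball is within \<open>norm x + R\<close> of
  \<open>x\<close>, so the tail of the kernel at scale \<open>\<epsilon>\<close> bounds the density
  from below, with logarithmic slope \<open>1 / \<epsilon>\<close>. All other terms are inflated to
  order \<open>1 / \<epsilon>\<close>, using \<open>\<epsilon> \<le> 1\<close> and, for the upper
  bound, \<open>ln (1 / \<epsilon>) \<le> 1 / \<epsilon> - 1\<close>.\<close>

lemma log_bound_N1:
  fixes \<rho> :: "'a::euclidean_space measure" and x :: 'a
  assumes \<epsilon>: "\<epsilon> \<in> {0<..1}" and \<rho>: "ball_prob R \<rho>"
  defines "u \<equiv> conv (rescale N1 \<epsilon>) \<rho> x" and "Z \<equiv> Z1 TYPE('a)"
  shows "0 < u" and "\<bar>1 + ln u\<bar> \<le> (1 + \<bar>ln Z\<bar> + DIM('a) + R) / \<epsilon> + 1 / \<epsilon> * norm x"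
proof -
  have \<epsilon>': "0 < \<epsilon>" "\<epsilon> \<le> 1" using \<epsilon> by auto
  have Z: "0 < Z" unfolding Z_def by (rule Z1_pos)
  have d: "0 < \<epsilon> ^ DIM('a)" "\<epsilon> ^ DIM('a) \<le> 1" using \<epsilon>' by (auto simp: power_le_one)
  have \<rho>': "prob_space \<rho>" "sets \<rho> = sets borel" "AE y in \<rho>. norm y \<le> R"
    using \<rho> by (auto simp: ball_prob_def)
  have R: "0 \<le> R"
  proof -
    interpret prob_space \<rho> by fact
    have "AE y in \<rho>. 0 \<le> R"
      using \<rho>'(3) by eventually_elim (use norm_ge_zero order_trans in blast)
    then show ?thesis by simp
  qed
  define lo where "lo = exp (- (1 + (norm x + R) / \<epsilon>)) / Z"
  have cont: "continuous_on UNIV (rescale (N1 :: 'a \<Rightarrow> real) \<epsilon>)"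
    using integrable_weight_N1[where 'a='a] by (intro continuous_on_rescale) (simp add: integrable_weight_def)
  have AE: "AE y in \<rho>. lo \<le> rescale N1 \<epsilon> (x - y)"
    using \<rho>'(3)
  proof eventually_elim
    case (elim y)
    have "norm ((x - y) /\<^sub>R \<epsilon>) = norm (x - y) / \<epsilon>"
      using \<epsilon>' by (simp add: divide_inverse)
    also have "\<dots> \<le> (norm x + R) / \<epsilon>"
      using \<epsilon>' elim norm_triangle_ineq4[of x y] by (intro divide_right_mono) auto
    finally have "bracket ((x - y) /\<^sub>R \<epsilon>) \<le> 1 + (norm x + R) / \<epsilon>"
      using bracket_le[of "(x - y) /\<^sub>R \<epsilon>"] by linarith
    then have "lo \<le> N1 ((x - y) /\<^sub>R \<epsilon>)"
      using Z by (simp add: lo_def N1_eq Z_def[symmetric] divide_right_mono)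
    also have "\<dots> \<le> rescale N1 \<epsilon> (x - y)"
      unfolding rescale_def using d N1_pos[of "(x - y) /\<^sub>R \<epsilon>"] by (simp add: pos_le_divide_eq mult_left_le)
    finally show ?case .
  qed
  have hi: "rescale N1 \<epsilon> z \<le> 1 / Z / \<epsilon> ^ DIM('a)" for z :: 'a
    unfolding rescale_def using d by (intro divide_right_mono) (auto simp: Z_def N1_le)
  have pos: "0 \<le> rescale N1 \<epsilon> z" for z :: 'a
    unfolding rescale_def using d N1_pos[of "z /\<^sub>R \<epsilon>"] by simp
  have u: "lo \<le> u" "u \<le> 1 / Z / \<epsilon> ^ DIM('a)"
    unfolding u_def by (rule conv_bounds[OF \<rho>'(1,2) cont AE hi pos])+
  have lo: "0 < lo" using Z by (simp add: lo_def)
  then show u0: "0 < u" using u by simp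
  have "ln lo \<le> ln u" using lo u by (intro ln_mono)
  then have lower: "- (1 + (norm x + R) / \<epsilon>) - ln Z \<le> ln u"
    using Z by (simp add: lo_def ln_div)
  have "ln u \<le> ln (1 / Z / \<epsilon> ^ DIM('a))" using u0 u by (intro ln_mono)
  also have "\<dots> = - ln Z + DIM('a) * (- ln \<epsilon>)"
    using Z \<epsilon>' by (simp add: ln_div ln_mult ln_realpow)
  also have "\<dots> \<le> - ln Z + DIM('a) * (1 / \<epsilon>)"
    using ln_le_minus_one[of "1 / \<epsilon>"] \<epsilon>' by (intro add_left_mono mult_left_mono) (auto simp: ln_div)
  finally have upper: "ln u \<le> - ln Z + DIM('a) / \<epsilon>" by simp
  have "1 \<le> 1 / \<epsilon>" using \<epsilon>' by simp
  moreover have "\<bar>ln Z\<bar> \<le> \<bar>ln Z\<bar> / \<epsilon>" using \<epsilon>' by (simp add: pos_le_divide_eq mult_left_le)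
  moreover have "0 \<le> norm x / \<epsilon>" "0 \<le> R / \<epsilon>" "0 \<le> DIM('a) / \<epsilon>" using \<epsilon>' R by auto
  moreover have "(1 + \<bar>ln Z\<bar> + DIM('a) + R) / \<epsilon> + 1 / \<epsilon> * norm x
      = 1 / \<epsilon> + \<bar>ln Z\<bar> / \<epsilon> + DIM('a) / \<epsilon> + R / \<epsilon> + norm x / \<epsilon>"
    "(norm x + R) / \<epsilon> = norm x / \<epsilon> + R / \<epsilon>"
    by (simp_all add: add_divide_distrib)
  ultimately show "\<bar>1 + ln u\<bar> \<le> (1 + \<bar>ln Z\<bar> + DIM('a) + R) / \<epsilon> + 1 / \<epsilon> * norm x"
    using lower upper by linarith
qed

text \<open>\<open>c\<close> and \<open>L\<close> are fixed while
  \<open>\<bar>ln \<sigma>\<bar>\<close> diverges, so both are eventually absorbed by the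
  logarithms; the moment factor stays between 1 and \<open>1 + m\<^sub>0 + m\<^sub>1\<close> for
  \<open>\<epsilon> < 1\<close>.\<close>

lemma bigtheta_log_constant:
  fixes c m\<^sub>0 m\<^sub>1 L :: real and n :: nat
  assumes "0 \<le> c" "0 \<le> m\<^sub>0" "0 \<le> m\<^sub>1"
  shows "(\<lambda>(\<epsilon>, \<sigma>). (c + (\<bar>ln \<sigma>\<bar> + n * \<bar>ln \<epsilon>\<bar>)) * (1 + m\<^sub>0 + m\<^sub>1 * \<epsilon>))
    \<in> \<Theta>[at_right 0 \<times>\<^sub>F at_right 0](\<lambda>(\<epsilon>, \<sigma>). \<bar>ln \<sigma>\<bar> + n * \<bar>ln \<epsilon>\<bar> + L)"
proof -
  \<comment> \<open>For the logarithmic sum \<open>X\<close> below, \<open>X \<ge> N\<close> yields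
    \<open>X \<le> 2 * \<bar>X + L\<bar>\<close> and \<open>c + X \<le> 2 * X\<close>, hence the
    factor 4. The term \<open>\<bar>ln \<sigma>\<bar>\<close> alone reaches \<open>N\<close>, the
    other term being nonnegative.\<close>
  define N where "N = 2 * \<bar>L\<bar> + c"
  have "\<forall>\<^sub>F \<epsilon> in at_right 0. \<epsilon> \<in> {0<..<1::real}"
    by (rule eventually_at_right_real) simp
  moreover have "\<forall>\<^sub>F \<sigma> in at_right 0. N \<le> \<bar>ln \<sigma>\<bar>"
  proof -
    have "\<forall>\<^sub>F \<sigma> in at_right 0. \<sigma> \<in> {0<..<exp (- N)}"
      by (rule eventually_at_right_real) simp
    then show ?thesis
    proof eventually_elim
      case (elim \<sigma>)
      then have "ln \<sigma> < ln (exp (- N))" by (subst ln_less_cancel_iff) auto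
      then show ?case by simp
    qed
  qed
  ultimately have ev: "\<forall>\<^sub>F p :: real \<times> real in at_right 0 \<times>\<^sub>F at_right 0. fst p \<in> {0<..<1} \<and> N \<le> \<bar>ln (snd p)\<bar>"
    unfolding eventually_prod_filter
    by - (rule exI[of _ "\<lambda>\<epsilon>. \<epsilon> \<in> {0<..<1}"], rule exI[of _ "\<lambda>\<sigma>. N \<le> \<bar>ln \<sigma>\<bar>"], simp)
  have bounds: "norm (case p of (\<epsilon>, \<sigma>) \<Rightarrow> (c + (\<bar>ln \<sigma>\<bar> + n * \<bar>ln \<epsilon>\<bar>)) * (1 + m\<^sub>0 + m\<^sub>1 * \<epsilon>))
      \<le> 4 * (1 + m\<^sub>0 + m\<^sub>1) * norm (case p of (\<epsilon>, \<sigma>) \<Rightarrow> \<bar>ln \<sigma>\<bar> + n * \<bar>ln \<epsilon>\<bar> + L) \<and>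
    norm (case p of (\<epsilon>, \<sigma>) \<Rightarrow> \<bar>ln \<sigma>\<bar> + n * \<bar>ln \<epsilon>\<bar> + L)
      \<le> 2 * norm (case p of (\<epsilon>, \<sigma>) \<Rightarrow> (c + (\<bar>ln \<sigma>\<bar> + n * \<bar>ln \<epsilon>\<bar>)) * (1 + m\<^sub>0 + m\<^sub>1 * \<epsilon>))"
    if p: "fst p \<in> {0<..<1} \<and> N \<le> \<bar>ln (snd p)\<bar>" for p :: "real \<times> real"
  proof -
    obtain \<epsilon> \<sigma> where p_eq: "p = (\<epsilon>, \<sigma>)" by (cases p)
    define X where "X = \<bar>ln \<sigma>\<bar> + n * \<bar>ln \<epsilon>\<bar>"
    have X: "2 * \<bar>L\<bar> + c \<le> X"
    proof -
      have "0 \<le> n * \<bar>ln \<epsilon>\<bar>" by simp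
      moreover have "2 * \<bar>L\<bar> + c \<le> \<bar>ln \<sigma>\<bar>" using p by (simp add: p_eq N_def)
      ultimately show ?thesis unfolding X_def by linarith
    qed
    have \<epsilon>: "0 < \<epsilon>" "\<epsilon> < 1" using p by (auto simp: p_eq)
    have m: "1 \<le> 1 + m\<^sub>0 + m\<^sub>1 * \<epsilon>" "1 + m\<^sub>0 + m\<^sub>1 * \<epsilon> \<le> 1 + m\<^sub>0 + m\<^sub>1"
      using assms \<epsilon> by (auto simp: mult_left_le)
    have X0: "0 \<le> X" by (simp add: X_def)
    have "(c + X) * (1 + m\<^sub>0 + m\<^sub>1 * \<epsilon>) \<le> (4 * \<bar>X + L\<bar>) * (1 + m\<^sub>0 + m\<^sub>1)"
      using X X0 assms m by (intro mult_mono) auto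
    then have 1: "(c + X) * (1 + m\<^sub>0 + m\<^sub>1 * \<epsilon>) \<le> 4 * (1 + m\<^sub>0 + m\<^sub>1) * \<bar>X + L\<bar>"
      by (simp add: mult_ac)
    have "\<bar>X + L\<bar> \<le> 2 * (c + X)"
      using abs_triangle_ineq[of X L] abs_ge_zero[of L] X X0 assms(1) by argo
    moreover have "(c + X) * 1 \<le> (c + X) * (1 + m\<^sub>0 + m\<^sub>1 * \<epsilon>)"
      using X0 assms m by (intro mult_left_mono) auto
    ultimately have 2: "\<bar>X + L\<bar> \<le> 2 * ((c + X) * (1 + m\<^sub>0 + m\<^sub>1 * \<epsilon>))"
      by linarith
    have "0 \<le> (c + X) * (1 + m\<^sub>0 + m\<^sub>1 * \<epsilon>)"
      using X0 assms m by simp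
    with 1 2 show ?thesis
      by (simp only: p_eq X_def[symmetric] prod.case real_norm_def abs_of_nonneg)
  qed
  show ?thesis
    by (rule bigthetaI'[of "1 / 2" "4 * (1 + m\<^sub>0 + m\<^sub>1)"])
      (use assms in \<open>auto intro!: eventually_mono[OF ev] dest!: bounds simp: mult_ac\<close>)
qed

section \<open>The two convexity statements with explicit constants\<close>

lemma regularized_entropy_semiconvex:
  fixes V :: "'a::euclidean_space \<Rightarrow> real"
  assumes V: "kernel_V1 V" "C2c V"
  shows "\<exists>C :: real \<Rightarrow> real \<Rightarrow> real.
        (\<forall>\<epsilon>>0. \<forall>\<sigma>\<in>{0<..<1}. C \<epsilon> \<sigma> > 0) \<and>
        (\<lambda>(\<epsilon>, \<sigma>). C \<epsilon> \<sigma>)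
          \<in> \<Theta>[at_right 0 \<times>\<^sub>F at_right 0](\<lambda>(\<epsilon>, \<sigma>). \<bar>ln \<sigma>\<bar> + DIM('a) * \<bar>ln \<epsilon>\<bar> + ln (Linf_norm V)) \<and>
        (\<forall>\<epsilon>>0. \<forall>\<sigma>\<in>{0<..<1}. \<forall>R\<^sub>0>0. \<forall>R\<^sub>1>0.
         \<forall>\<rho>\<^sub>0\<in>P2. \<forall>\<rho>\<^sub>1\<in>P2. \<forall>\<gamma> :: ('a \<times> 'a) measure.
          supp \<rho>\<^sub>0 = cball 0 R\<^sub>0 \<and> supp \<rho>\<^sub>1 = cball 0 R\<^sub>1 \<and> optimal_plan \<gamma> \<rho>\<^sub>0 \<rho>\<^sub>1 \<longrightarrow>
          (let l = - (1 / \<epsilon>\<^sup>2) * C \<epsilon> \<sigma> * (1 - \<sigma>) * (1 + R\<^sub>0 + R\<^sub>1);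
               H = entropy_reg V \<epsilon> \<sigma>
           in (\<exists>D. ((\<lambda>\<alpha>. H (geodesic \<gamma> \<alpha>)) has_real_derivative D) (at_right 0) \<and>
                   H \<rho>\<^sub>1 - H \<rho>\<^sub>0 - D \<ge> l / 2 * (d\<^sub>W \<rho>\<^sub>0 \<rho>\<^sub>1)\<^sup>2) \<and>
              convex_along l H (geodesic \<gamma>)))"
proof -
  let ?Z = "Z1 TYPE('a)"
  obtain M where dom: "dominated_kernel V 1 M"
    using dominated_kernel_C2c[OF V] by blast
  then have M: "integrable_weight M" and V': "continuous_on UNIV V" "\<And>x. 0 \<le> V x"
    and "bounded (range V)"
    by (auto simp: dominated_kernel_def)
  \<comment> \<open>\<open>S\<close> stands in for the supremum norm: both are fixed by
    \<open>V\<close>, so the difference between their logarithms disappears under \<Theta>.\<close>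
  then obtain S where S: "0 < S" "\<And>x. V x \<le> S"
    unfolding bounded_pos by (auto intro: order_trans[OF abs_ge_self])
  define m\<^sub>0 where "m\<^sub>0 = (\<integral>x. M x \<partial>lborel)"
  define m\<^sub>1 where "m\<^sub>1 = (\<integral>x. norm x * M x \<partial>lborel)"
  have m: "0 \<le> m\<^sub>0" "0 \<le> m\<^sub>1"
    unfolding m\<^sub>0_def m\<^sub>1_def using integrable_weightD(2)[OF M] by (auto intro!: integral_nonneg_AE)
  define c where "c = 3 + \<bar>ln ?Z\<bar> + \<bar>ln (S + 1 / ?Z)\<bar>"
  define X where "X \<epsilon> \<sigma> = \<bar>ln \<sigma>\<bar> + DIM('a) * \<bar>ln \<epsilon>\<bar>" for \<epsilon> \<sigma> :: real
  \<comment> \<open>Modelled on \<open>moment_bound\<close> with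
    \<open>A = c + X \<epsilon> \<sigma>\<close> and \<open>B = 1\<close>, where the first moment
    carries \<open>\<epsilon>\<close>. The summand 1 keeps the moment factor away from 0, for
    positivity and for the lower half of \<Theta>.\<close>
  define C where "C \<epsilon> \<sigma> = (c + X \<epsilon> \<sigma>) * (1 + m\<^sub>0 + m\<^sub>1 * \<epsilon>)" for \<epsilon> \<sigma>
  have c: "3 \<le> c" by (simp add: c_def)
  have X: "0 \<le> X \<epsilon> \<sigma>" for \<epsilon> \<sigma> by (simp add: X_def)
  show ?thesis
    unfolding Let_def
  proof (intro exI[of _ C] conjI[of "\<forall>\<epsilon>>0. \<forall>\<sigma>\<in>{0<..<1}. C \<epsilon> \<sigma> > 0"] conjI[of "_ \<in> \<Theta>[_](_)"] allI ballI impI, goal_cases)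
    case (1 \<epsilon> \<sigma>)
    have "0 \<le> m\<^sub>1 * \<epsilon>" using m 1 by simp
    then show ?case
      unfolding C_def using m c X[of \<epsilon> \<sigma>] by (intro mult_pos_pos) auto
  next
    case 2
    show ?case
      unfolding C_def X_def using c m by (intro bigtheta_log_constant) auto
  next
    case (3 \<epsilon> \<sigma> R\<^sub>0 R\<^sub>1 \<rho>\<^sub>0 \<rho>\<^sub>1 \<gamma>)
    then have \<epsilon>: "0 < \<epsilon>" and \<sigma>: "\<sigma> \<in> {0<..<1}" and R: "0 < R\<^sub>0" "0 < R\<^sub>1" by auto
    define R where "R = max R\<^sub>0 R\<^sub>1"
    have reg: "regularized_entropy (rescale V \<epsilon>) (rescale M \<epsilon>) (\<lambda>x. \<sigma> * N1 x) (1 / \<epsilon>) (1 - \<sigma>) R (c + X \<epsilon> \<sigma>) 1"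
    proof
      show "dominated_kernel (rescale V \<epsilon>) (1 / \<epsilon>) (rescale M \<epsilon>)"
        by (rule dominated_kernel_rescale[OF dom \<epsilon>])
      show "integrable_weight (\<lambda>x :: 'a. \<sigma> * N1 x)"
        using integrable_weight_N1[where 'a='a] \<sigma>
        by (auto simp: integrable_weight_def mult.left_commute[of _ \<sigma>] intro!: continuous_intros)
      show "0 < (1 - \<sigma>) * conv (rescale V \<epsilon>) \<rho> x + \<sigma> * N1 x \<and>
        \<bar>1 + ln ((1 - \<sigma>) * conv (rescale V \<epsilon>) \<rho> x + \<sigma> * N1 x)\<bar> \<le> c + X \<epsilon> \<sigma> + 1 * norm x"
        if "ball_prob R \<rho>" for \<rho> x
        unfolding c_def X_def
        using log_bound_regularized[OF V' S(2,1) \<epsilon> \<sigma>, of \<rho> x] that by (simp add: ball_prob_def)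
    qed (use \<epsilon> \<sigma> R c X[of \<epsilon> \<sigma>] in \<open>auto simp: R_def\<close>)
    have "(c + X \<epsilon> \<sigma> + 1 * R) * m\<^sub>0 + 1 * \<epsilon> * m\<^sub>1 \<le> C \<epsilon> \<sigma> * (1 + R\<^sub>0 + R\<^sub>1)"
    proof -
      have R1: "R \<le> R\<^sub>0 + R\<^sub>1" "0 \<le> R" using R by (auto simp: R_def)
      define b where "b = c + X \<epsilon> \<sigma>"
      have b: "1 \<le> b" using c X[of \<epsilon> \<sigma>] by (simp add: b_def)
      \<comment> \<open>Since \<open>b \<ge> 1\<close>, the additive radius can be made
        multiplicative, separating it from the part that depends on \<open>\<epsilon>\<close> and
        \<open>\<sigma>\<close>.\<close>
      have "b + R \<le> b * (1 + R)"
        using mult_right_mono[OF b R1(2)] by (simp add: algebra_simps)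
      also have "\<dots> \<le> b * (1 + R\<^sub>0 + R\<^sub>1)" using b R1 by (intro mult_left_mono) auto
      finally have "(b + R) * m\<^sub>0 \<le> b * (1 + R\<^sub>0 + R\<^sub>1) * m\<^sub>0" using m by (intro mult_right_mono)
      moreover have "1 * (\<epsilon> * m\<^sub>1) \<le> b * (1 + R\<^sub>0 + R\<^sub>1) * (\<epsilon> * m\<^sub>1)"
      proof (rule mult_right_mono)
        have "1 * 1 \<le> b * (1 + R\<^sub>0 + R\<^sub>1)" using b R by (intro mult_mono) auto
        then show "1 \<le> b * (1 + R\<^sub>0 + R\<^sub>1)" by simp
      qed (use \<epsilon> m in simp)
      moreover have "0 \<le> b * (1 + R\<^sub>0 + R\<^sub>1)" using b R by simp
      ultimately show ?thesis by (simp add: C_def b_def[symmetric] algebra_simps)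
    qed
    then have "(1 - \<sigma>) * (1 / \<epsilon>)\<^sup>2 * moment_bound (rescale M \<epsilon>) (c + X \<epsilon> \<sigma>) 1 R
        \<le> (1 - \<sigma>) * (1 / \<epsilon>)\<^sup>2 * (C \<epsilon> \<sigma> * (1 + R\<^sub>0 + R\<^sub>1))"
      unfolding integrable_weight_rescale(2)[OF M \<epsilon>] m\<^sub>0_def[symmetric] m\<^sub>1_def[symmetric]
      using \<sigma> by (intro mult_left_mono) auto
    also have "\<dots> = - (- (1 / \<epsilon>\<^sup>2) * C \<epsilon> \<sigma> * (1 - \<sigma>) * (1 + R\<^sub>0 + R\<^sub>1))"
      by (simp add: power_one_over)
    finally show ?case
      using 3 reg unfolding R_def by (intro geodesic_inequalities) auto
  qed
qed

lemma N1_entropy_semiconvex: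
  shows "\<exists>C :: real \<Rightarrow> real.
      (\<forall>R>0. C R > 0) \<and>
      (\<forall>\<epsilon>\<in>{0<..1}. \<forall>R\<^sub>0>0. \<forall>R\<^sub>1>0. \<forall>R>0.
       \<forall>\<rho>\<^sub>0\<in>P2. \<forall>\<rho>\<^sub>1\<in>P2. \<forall>\<gamma> :: ('a::euclidean_space \<times> 'a) measure.
        supp \<rho>\<^sub>0 = cball 0 R\<^sub>0 \<and> supp \<rho>\<^sub>1 = cball 0 R\<^sub>1 \<and> optimal_plan \<gamma> \<rho>\<^sub>0 \<rho>\<^sub>1 \<and>
        measure \<rho>\<^sub>0 (cball 0 R) \<ge> 1 / 2 \<longrightarrow>
        (let l = - (1 / \<epsilon> ^ 3) * C R * (1 + R\<^sub>0 + R\<^sub>1);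
             H = entropy_eps N1 \<epsilon>
         in (\<exists>D. ((\<lambda>\<alpha>. H (geodesic \<gamma> \<alpha>)) has_real_derivative D) (at_right 0) \<and>
                 H \<rho>\<^sub>1 - H \<rho>\<^sub>0 - D \<ge> l / 2 * (d\<^sub>W \<rho>\<^sub>0 \<rho>\<^sub>1)\<^sup>2) \<and>
            convex_along l H (geodesic \<gamma>)))"
proof -
  let ?Z = "Z1 TYPE('a)"
  define m\<^sub>0 where "m\<^sub>0 = (\<integral>x. N1 (x :: 'a) \<partial>lborel)"
  define m\<^sub>1 where "m\<^sub>1 = (\<integral>x. norm x * N1 (x :: 'a) \<partial>lborel)"
  note M = integrable_weight_N1[where 'a='a]
  have m: "0 \<le> m\<^sub>0" "0 \<le> m\<^sub>1"
    unfolding m\<^sub>0_def m\<^sub>1_def using integrable_weightD(2)[OF M] by (auto intro!: integral_nonneg_AE)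
  define q where "q = 1 + \<bar>ln ?Z\<bar> + DIM('a)"
  \<comment> \<open>Chosen to dominate
    \<open>(q + 2 * R) * m\<^sub>0 + \<epsilon> * m\<^sub>1\<close> after division by
    \<open>1 + R\<^sub>0 + R\<^sub>1\<close>. The local \<open>R\<close>, the larger support radius,
    counts twice: once in the logarithmic bound and once in the shift of the weight. The summand 1
    gives strict positivity.\<close>
  define C where "C = (q + 2) * m\<^sub>0 + m\<^sub>1 + 1"
  have q: "1 \<le> q" by (simp add: q_def)
  show ?thesis
    unfolding Let_def
  proof (intro exI[of _ "\<lambda>_. C"] conjI[of "\<forall>R>0. C > 0"] allI ballI impI, goal_cases)
    case 1
    show ?case unfolding C_def using q m by (intro add_nonneg_pos add_nonneg_nonneg mult_nonneg_nonneg) auto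
  next
    case (2 \<epsilon> R\<^sub>0 R\<^sub>1 _ \<rho>\<^sub>0 \<rho>\<^sub>1 \<gamma>)
    then have \<epsilon>: "\<epsilon> \<in> {0<..1}" "0 < \<epsilon>" and R: "0 < R\<^sub>0" "0 < R\<^sub>1" by auto
    define R where "R = max R\<^sub>0 R\<^sub>1"
    have R1: "R \<le> R\<^sub>0 + R\<^sub>1" "0 \<le> R" using R by (auto simp: R_def)
    \<comment> \<open>The forms \<open>1 - 0\<close> and \<open>0 * N1 x\<close> are those of
      \<open>entropy_reg\<close> at \<open>\<sigma> = 0\<close>, so that
      \<open>geodesic_inequalities\<close> applies directly.\<close>
    have reg: "regularized_entropy (rescale N1 \<epsilon>) (rescale N1 \<epsilon>) (\<lambda>x :: 'a. 0 * N1 x) (1 / \<epsilon>) (1 - 0) R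
        ((q + R) / \<epsilon>) (1 / \<epsilon>)"
    proof
      show "dominated_kernel (rescale N1 \<epsilon> :: 'a \<Rightarrow> real) (1 / \<epsilon>) (rescale N1 \<epsilon>)"
        by (rule dominated_kernel_rescale[OF dominated_kernel_N1 \<epsilon>(2)])
      show "integrable_weight (\<lambda>x :: 'a. 0 * N1 x)"
        by (simp add: integrable_weight_def)
      show "0 < (1 - 0) * conv (rescale N1 \<epsilon>) \<rho> x + 0 * N1 x \<and>
        \<bar>1 + ln ((1 - 0) * conv (rescale N1 \<epsilon>) \<rho> x + 0 * N1 x)\<bar> \<le> (q + R) / \<epsilon> + 1 / \<epsilon> * norm x"
        if "ball_prob R \<rho>" for \<rho> and x :: 'a
        unfolding q_def using log_bound_N1[OF \<epsilon>(1) that, of x] by simp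
    qed (use \<epsilon> R1 q in auto)
    have "(1 - 0) * (1 / \<epsilon>)\<^sup>2 * moment_bound (rescale N1 \<epsilon> :: 'a \<Rightarrow> real) ((q + R) / \<epsilon>) (1 / \<epsilon>) R
        = 1 / \<epsilon> ^ 3 * ((q + 2 * R) * m\<^sub>0 + \<epsilon> * m\<^sub>1)"
      unfolding integrable_weight_rescale(2)[OF M \<epsilon>(2)] m\<^sub>0_def[symmetric] m\<^sub>1_def[symmetric]
      using \<epsilon> by (simp add: field_simps power2_eq_square power3_eq_cube)
    also have "\<dots> \<le> 1 / \<epsilon> ^ 3 * (C * (1 + R\<^sub>0 + R\<^sub>1))"
    proof (rule mult_left_mono)
      have "q + 2 * R \<le> (q + 2) * (1 + R\<^sub>0 + R\<^sub>1)"
      proof -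
        have "0 \<le> q * (R\<^sub>0 + R\<^sub>1)" using q R by simp
        then show ?thesis using R1 by (simp add: algebra_simps)
      qed
      then have "(q + 2 * R) * m\<^sub>0 \<le> (q + 2) * (1 + R\<^sub>0 + R\<^sub>1) * m\<^sub>0"
        using m by (intro mult_right_mono)
      moreover have "\<epsilon> * m\<^sub>1 \<le> (1 + R\<^sub>0 + R\<^sub>1) * m\<^sub>1"
        using m \<epsilon> R by (intro mult_right_mono) auto
      ultimately show "(q + 2 * R) * m\<^sub>0 + \<epsilon> * m\<^sub>1 \<le> C * (1 + R\<^sub>0 + R\<^sub>1)"
        using R by (simp add: C_def algebra_simps)
    qed (use \<epsilon> in simp)
    also have "\<dots> = - (- (1 / \<epsilon> ^ 3) * C * (1 + R\<^sub>0 + R\<^sub>1))"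
      by simp
    finally show ?case
      using 2 reg unfolding R_def entropy_eps_def by (intro geodesic_inequalities) auto
  qed
qed

theorem proposition5p4:
  shows
   "(\<forall>V :: 'a::euclidean_space \<Rightarrow> real. kernel_V1 V \<and> C2c V \<longrightarrow>
      (\<exists>C :: real \<Rightarrow> real \<Rightarrow> real.
        (\<forall>\<epsilon>>0. \<forall>\<sigma>\<in>{0<..<1}. C \<epsilon> \<sigma> > 0) \<and>
        (\<lambda>(\<epsilon>, \<sigma>). C \<epsilon> \<sigma>)
          \<in> \<Theta>[at_right 0 \<times>\<^sub>F at_right 0](\<lambda>(\<epsilon>, \<sigma>). \<bar>ln \<sigma>\<bar> + DIM('a) * \<bar>ln \<epsilon>\<bar> + ln (Linf_norm V)) \<and>
        (\<forall>\<epsilon>>0. \<forall>\<sigma>\<in>{0<..<1}. \<forall>R\<^sub>0>0. \<forall>R\<^sub>1>0.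
         \<forall>\<rho>\<^sub>0\<in>P2. \<forall>\<rho>\<^sub>1\<in>P2. \<forall>\<gamma> :: ('a \<times> 'a) measure.
          supp \<rho>\<^sub>0 = cball 0 R\<^sub>0 \<and> supp \<rho>\<^sub>1 = cball 0 R\<^sub>1 \<and> optimal_plan \<gamma> \<rho>\<^sub>0 \<rho>\<^sub>1 \<longrightarrow>
          (let l = - (1 / \<epsilon>\<^sup>2) * C \<epsilon> \<sigma> * (1 - \<sigma>) * (1 + R\<^sub>0 + R\<^sub>1);
               H = entropy_reg V \<epsilon> \<sigma>
           in (\<exists>D. ((\<lambda>\<alpha>. H (geodesic \<gamma> \<alpha>)) has_real_derivative D) (at_right 0) \<and>
                   H \<rho>\<^sub>1 - H \<rho>\<^sub>0 - D \<ge> l / 2 * (d\<^sub>W \<rho>\<^sub>0 \<rho>\<^sub>1)\<^sup>2) \<and>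
              convex_along l H (geodesic \<gamma>)))))
    \<and>
    (\<exists>C :: real \<Rightarrow> real.
      (\<forall>R>0. C R > 0) \<and>
      (\<forall>\<epsilon>\<in>{0<..1}. \<forall>R\<^sub>0>0. \<forall>R\<^sub>1>0. \<forall>R>0.
       \<forall>\<rho>\<^sub>0\<in>P2. \<forall>\<rho>\<^sub>1\<in>P2. \<forall>\<gamma> :: ('a \<times> 'a) measure.
        supp \<rho>\<^sub>0 = cball 0 R\<^sub>0 \<and> supp \<rho>\<^sub>1 = cball 0 R\<^sub>1 \<and> optimal_plan \<gamma> \<rho>\<^sub>0 \<rho>\<^sub>1 \<and>
        measure \<rho>\<^sub>0 (cball 0 R) \<ge> 1 / 2 \<longrightarrow>
        (let l = - (1 / \<epsilon> ^ 3) * C R * (1 + R\<^sub>0 + R\<^sub>1);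
             H = entropy_eps N1 \<epsilon>
         in (\<exists>D. ((\<lambda>\<alpha>. H (geodesic \<gamma> \<alpha>)) has_real_derivative D) (at_right 0) \<and>
                 H \<rho>\<^sub>1 - H \<rho>\<^sub>0 - D \<ge> l / 2 * (d\<^sub>W \<rho>\<^sub>0 \<rho>\<^sub>1)\<^sup>2) \<and>
            convex_along l H (geodesic \<gamma>))))"
  by (intro conjI allI impI N1_entropy_semiconvex regularized_entropy_semiconvex; elim conjE)

end
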